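(* Let $r\ge1$. The algebra $C_r$ is tightly graded if and only if $r=1$ or $r=4$.
   Context: $k$ is an algebraically closed field of characteristic 2. A finite dimensional $k$-algebra $A$ is tightly graded if there is an algebra isomorphism $A\cong\mathrm{gr}_{\mathrm{rad}A}(A)$, where $\mathrm{gr}_{\mathrm{rad}A}(A)$ is the graded algebra associated with the radical filtration. Equivalently, there is a positive grading $A=\bigoplus_{i\ge0}A_i$ with $A_0$ semisimple and $A$ generated as an algebra by $A_0$ and $A_1$. Algebras are quotients of path algebras over $k$; paths are written left to right, i.e. $xy$ means first $x$, then $y$. For $r\ge2$, $C_r$ has vertices $1,2,3$; arrows $a_1:1\to2$, $b_1:2\to1$, $a_2:2\to3$, $b_2:3\to2$, and a loop $c$ at $3$; relations $a_1b_1=b_2a_2=a_2c=cb_2=0$, $c^r=b_2b_1a_1a_2$, $a_2b_2b_1a_1=b_1a_1a_2b_2$. For $r=1$, $C_1:=A_1$, the algebra with vertices $1,2,3$; arrows $a_1:1\to2$, $a_2:2\to1$, $b_1:1\to3$, $b_2:3\to1$; relations $a_2a_1=b_2b_1=0$, $a_1a_2b_1b_2=b_1b_2a_1a_2$. *)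

theory Defs
  imports
    "HOL-Library.Poly_Mapping"
    "HOL-Computational_Algebra.Polynomial"
    "HOL-Algebra.Module"
    "HOL-Algebra.QuotRing"
    "HOL-Algebra.Ideal_Product"
    "Graph_Theory.Arc_Walk"
begin

section \<open>Associative algebras, the radical, and associated graded algebras\<close>

text \<open>
  An associative algebra over the field \<^typ>\<open>'k\<close> is a record \<^typ>\<open>('k, 'a) module\<close>: a ring with
  an additional operation \<^const>\<open>smult\<close>. (The library's locale for algebras over a commutative ring
  also requires multiplication to be commutative, so only its record type is used.)
\<close>

definition algebra_iso :: "('k, 'a) module \<Rightarrow> ('k, 'b) module \<Rightarrow> ('a \<Rightarrow> 'b) set" where
  "algebra_iso A B =
     {f \<in> ring_iso A B. \<forall>s. \<forall>x\<in>carrier A. f (s \<odot>\<^bsub>A\<^esub> x) = s \<odot>\<^bsub>B\<^esub> f x}"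

definition coset_smult :: "('k, 'a) module \<Rightarrow> 'a set \<Rightarrow> 'k \<Rightarrow> 'a set \<Rightarrow> 'a set" where
  "coset_smult A I s X = (\<Union>x\<in>X. I +>\<^bsub>A\<^esub> (s \<odot>\<^bsub>A\<^esub> x))"

definition quotient_algebra :: "('k, 'a) module \<Rightarrow> 'a set \<Rightarrow> ('k, 'a set) module" where
  "quotient_algebra A I = ring.extend (A Quot I) (module.fields (coset_smult A I))"

definition right_ideal :: "'a set \<Rightarrow> ('a, 'm) ring_scheme \<Rightarrow> bool" where
  "right_ideal I A \<longleftrightarrow>
     additive_subgroup I A \<and> (\<forall>a\<in>I. \<forall>x\<in>carrier A. a \<otimes>\<^bsub>A\<^esub> x \<in> I)"

definition maximal_right_ideal :: "'a set \<Rightarrow> ('a, 'm) ring_scheme \<Rightarrow> bool" where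
  "maximal_right_ideal M A \<longleftrightarrow>
     right_ideal M A \<and> M \<noteq> carrier A \<and>
     (\<forall>I. right_ideal I A \<and> M \<subseteq> I \<longrightarrow> I = M \<or> I = carrier A)"

definition jacobson_radical :: "('a, 'm) ring_scheme \<Rightarrow> 'a set" where
  "jacobson_radical A = carrier A \<inter> \<Inter>{M. maximal_right_ideal M A}"

primrec ideal_power :: "('a, 'm) ring_scheme \<Rightarrow> 'a set \<Rightarrow> nat \<Rightarrow> 'a set" where
  "ideal_power A I 0 = carrier A"
| "ideal_power A I (Suc n) = ideal_prod A (ideal_power A I n) I"

text \<open>
  The algebra \<open>gr\<^sub>I(A)\<close>, the direct sum of the quotients \<open>I\<^sup>n / I\<^sup>n\<^sup>+\<^sup>1\<close> over \<open>n \<ge> 0\<close>. An element is the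
  sequence of its homogeneous components; the component of degree \<open>n\<close> is a coset of \<open>I\<^sup>n\<^sup>+\<^sup>1\<close>
  contained in \<open>I\<^sup>n\<close>, i.e. an element of the quotient of \<open>A\<close> by \<open>I\<^sup>n\<^sup>+\<^sup>1\<close>, and almost all components
  are zero. The product of \<open>a + I\<^sup>i\<^sup>+\<^sup>1\<close> and \<open>b + I\<^sup>j\<^sup>+\<^sup>1\<close> is \<open>ab + I\<^sup>i\<^sup>+\<^sup>j\<^sup>+\<^sup>1\<close>.
\<close>

definition assoc_graded :: "('k, 'a) module \<Rightarrow> 'a set \<Rightarrow> ('k, nat \<Rightarrow> 'a set) module" where
  "assoc_graded A I =
     \<lparr>carrier = {x. (\<forall>n. \<exists>a\<in>ideal_power A I n. x n = ideal_power A I (Suc n) +>\<^bsub>A\<^esub> a) \<and>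
                    finite {n. x n \<noteq> ideal_power A I (Suc n)}},
      monoid.mult = (\<lambda>x y n. \<Oplus>\<^bsub>A Quot ideal_power A I (Suc n)\<^esub>i\<in>{..n}.
                        rcoset_mult A (ideal_power A I (Suc n)) (x i) (y (n - i))),
      one = (\<lambda>n. if n = 0 then ideal_power A I (Suc 0) +>\<^bsub>A\<^esub> \<one>\<^bsub>A\<^esub> else ideal_power A I (Suc n)),
      zero = (\<lambda>n. ideal_power A I (Suc n)),
      add = (\<lambda>x y n. x n <+>\<^bsub>A\<^esub> y n),
      smult = (\<lambda>s x n. coset_smult A (ideal_power A I (Suc n)) s (x n))\<rparr>"

definition tightly_graded :: "('k, 'a) module \<Rightarrow> bool" where
  "tightly_graded A \<longleftrightarrow> algebra_iso A (assoc_graded A (jacobson_radical A)) \<noteq> {}"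


section \<open>Path algebras\<close>

text \<open>
  Quivers are the directed multigraphs \<^typ>\<open>('v, 'e) pre_digraph\<close>. The triple \<open>(u, p, v)\<close> is the path
  from \<open>u\<close> to \<open>v\<close> that traverses the list of arrows \<open>p\<close> from left to right; \<open>(v, [], v)\<close> is the
  trivial path at \<open>v\<close>.
\<close>

type_synonym ('v, 'e) path = "'v \<times> 'e list \<times> 'v"

definition paths :: "('v, 'e) pre_digraph \<Rightarrow> ('v, 'e) path set" where
  "paths Q = {(u, p, v). pre_digraph.awalk Q u p v}"

fun path_prod :: "('v, 'e) path \<Rightarrow> ('v, 'e) path \<Rightarrow> ('v, 'e) path \<Rightarrow>\<^sub>0 'k::field" where
  "path_prod (u, p, v) (v', q, w) = (if v = v' then Poly_Mapping.single (u, p @ q, w) 1 else 0)"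

definition path_algebra ::
  "('v, 'e) pre_digraph \<Rightarrow> ('k::field, ('v, 'e) path \<Rightarrow>\<^sub>0 'k) module" where
  "path_algebra Q =
     \<lparr>carrier = {f. Poly_Mapping.keys f \<subseteq> paths Q},
      monoid.mult = (\<lambda>f g. \<Sum>p\<in>Poly_Mapping.keys f. \<Sum>q\<in>Poly_Mapping.keys g.
                        Poly_Mapping.map ((*) (Poly_Mapping.lookup f p * Poly_Mapping.lookup g q))
                          (path_prod p q)),
      one = (\<Sum>v\<in>verts Q. Poly_Mapping.single (v, [], v) 1),
      zero = 0,
      add = (+),
      smult = (\<lambda>s. Poly_Mapping.map ((*) s))\<rparr>"

text \<open>The path traversing the arrows \<open>p\<close> (a nonempty list of composable arrows).\<close>

definition path_of :: "('v, 'e) pre_digraph \<Rightarrow> 'e list \<Rightarrow> ('v, 'e) path \<Rightarrow>\<^sub>0 'k::field" where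
  "path_of Q p = Poly_Mapping.single (tail Q (hd p), p, head Q (last p)) 1"

text \<open>The quotient of the path algebra of \<open>Q\<close> by the relations \<open>x = y\<close> for all \<open>(x, y) \<in> R\<close>.\<close>

definition quiver_algebra ::
  "('v, 'e) pre_digraph \<Rightarrow> ((('v, 'e) path \<Rightarrow>\<^sub>0 'k) \<times> (('v, 'e) path \<Rightarrow>\<^sub>0 'k)) set \<Rightarrow>
    ('k::field, (('v, 'e) path \<Rightarrow>\<^sub>0 'k) set) module" where
  "quiver_algebra Q R =
     quotient_algebra (path_algebra Q) (Idl\<^bsub>path_algebra Q\<^esub> {x - y | x y. (x, y) \<in> R})"


section \<open>The algebras \<open>C\<^sub>r\<close>\<close>

datatype arrow = A1 | B1 | A2 | B2 | C

definition quiver_A1 :: "(nat, arrow) pre_digraph" where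
  "quiver_A1 =
     \<lparr>verts = {1, 2, 3}, arcs = {A1, A2, B1, B2},
      tail = (\<lambda>e. case e of A1 \<Rightarrow> 1 | A2 \<Rightarrow> 2 | B1 \<Rightarrow> 1 | B2 \<Rightarrow> 3 | C \<Rightarrow> undefined),
      head = (\<lambda>e. case e of A1 \<Rightarrow> 2 | A2 \<Rightarrow> 1 | B1 \<Rightarrow> 3 | B2 \<Rightarrow> 1 | C \<Rightarrow> undefined)\<rparr>"

definition algebra_A1 :: "('k::field, ((nat, arrow) path \<Rightarrow>\<^sub>0 'k) set) module" where
  "algebra_A1 =
     (let w = path_of quiver_A1
      in quiver_algebra quiver_A1
           {(w [A2, A1], 0), (w [B2, B1], 0),
            (w [A1, A2, B1, B2], w [B1, B2, A1, A2])})"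

definition quiver_C :: "(nat, arrow) pre_digraph" where
  "quiver_C =
     \<lparr>verts = {1, 2, 3}, arcs = {A1, B1, A2, B2, C},
      tail = (\<lambda>e. case e of A1 \<Rightarrow> 1 | B1 \<Rightarrow> 2 | A2 \<Rightarrow> 2 | B2 \<Rightarrow> 3 | C \<Rightarrow> 3),
      head = (\<lambda>e. case e of A1 \<Rightarrow> 2 | B1 \<Rightarrow> 1 | A2 \<Rightarrow> 3 | B2 \<Rightarrow> 2 | C \<Rightarrow> 3)\<rparr>"

text \<open>
  By convention, \<open>C\<^sub>1\<close> is the algebra \<open>A\<^sub>1\<close>, which is not given by the presentation used for
  \<open>r \<ge> 2\<close>. The value at \<open>r = 0\<close> has no meaning.
\<close>

definition algebra_C :: "nat \<Rightarrow> ('k::field, ((nat, arrow) path \<Rightarrow>\<^sub>0 'k) set) module" where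
  "algebra_C r =
     (if r = 1 then algebra_A1
      else let w = path_of quiver_C
           in quiver_algebra quiver_C
                {(w [A1, B1], 0), (w [B2, A2], 0), (w [A2, C], 0), (w [C, B2], 0),
                 (w (replicate r C), w [B2, B1, A1, A2]),
                 (w [A2, B2, B1, A1], w [B1, A1, A2, B2])})"

end

theory Submission
  imports Defs
begin

text \<open>
  Let \<open>A = kQ/I\<close>, where \<open>I\<close> lies in the ideal generated by the arrows and contains all sufficiently
  long paths. The arrows generate a nilpotent ideal of \<open>A\<close>, which lies in every maximal right ideal,
  and modulo this ideal \<open>A\<close> is a product of copies of \<open>k\<close>, one for each vertex. Hence this ideal is the
  Jacobson radical, and its \<open>n\<close>-th power consists of the classes of the linear combinations of paths
  of length at least \<open>n\<close> (\<open>jacobson_radical_A\<close>, \<open>ideal_power_cls_F\<close>).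

  If the relations are homogeneous for the length of paths, then \<open>A\<close> is the direct sum of its
  homogeneous parts, and sending an element to the sequence of these parts is an isomorphism with the
  associated graded algebra (\<open>tightly_graded_if_homogeneous\<close>). This covers \<open>A\<^sub>1\<close> and \<open>C\<^sub>4\<close>.

  For the other values of \<open>r\<close> the two sides of \<open>c\<^sup>r = b\<^sub>2 b\<^sub>1 a\<^sub>1 a\<^sub>2\<close> have different lengths. In \<open>C\<^sub>r\<close>, an
  element that is killed by right multiplication with the radical lies in the fourth power of the
  radical. Indeed, every nonzero path of \<open>C\<^sub>r\<close> can be prolonged to \<open>c\<^sup>r\<close> or to one of the four rotations of
  \<open>a\<^sub>1 a\<^sub>2 b\<^sub>2 b\<^sub>1\<close>, and the linear form that adds up the coefficients of these five words is compatible with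
  the relations; it shows that such an element involves none of their proper prefixes
  (\<open>socle_in_K\<close>). In the associated graded algebra, on the other hand, the shorter side of the
  relation vanishes, because it equals an element of a higher power of the radical. So the path \<open>y\<close>
  obtained from the shorter side by deleting its last arrow (\<open>c\<^sup>r\<^sup>-\<^sup>1\<close> for \<open>r < 4\<close>, and \<open>b\<^sub>2 b\<^sub>1 a\<^sub>1\<close> for
  \<open>r > 4\<close>) gives a nonzero element of degree at most 3 that is killed by right multiplication with
  everything of positive degree. An isomorphism would match this element with an element of \<open>C\<^sub>r\<close> killed by the radical,
  thus with an element of the fourth power of the radical, whose image has no components of degree
  less than 4 (\<open>tightly_graded_socle\<close>). This is a contradiction.
\<close>

section \<open>Finitely supported functions\<close>

abbreviation keys :: "('a \<Rightarrow>\<^sub>0 'b::zero) \<Rightarrow> 'a set" where "keys \<equiv> Poly_Mapping.keys"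
abbreviation coeff_at :: "('a \<Rightarrow>\<^sub>0 'b::zero) \<Rightarrow> 'a \<Rightarrow> 'b" where "coeff_at \<equiv> Poly_Mapping.lookup"
abbreviation term_of :: "'a \<Rightarrow> 'b \<Rightarrow> 'a \<Rightarrow>\<^sub>0 'b::zero" where "term_of \<equiv> Poly_Mapping.single"
abbreviation scale :: "'k \<Rightarrow> ('a \<Rightarrow>\<^sub>0 'k) \<Rightarrow> 'a \<Rightarrow>\<^sub>0 'k::field" where
  "scale s \<equiv> Poly_Mapping.map ((*) s)"
abbreviation path_length :: "('v, 'e) path \<Rightarrow> nat" where "path_length t \<equiv> length (fst (snd t))"

lemma lookup_scale [simp]: "coeff_at (scale s f) t = s * coeff_at f t"
  by (auto simp: Poly_Mapping.map.rep_eq when_def)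

lemma scale_add: "scale s (f + g) = scale s f + scale s g"
  by (intro poly_mapping_eqI) (simp add: lookup_add distrib_left)

lemma scale_diff: "scale s (f - g) = scale s f - scale s g"
  by (intro poly_mapping_eqI) (simp add: lookup_minus right_diff_distrib)

lemma scale_zero [simp]: "scale s 0 = 0"
  by (intro poly_mapping_eqI) simp

lemma scale_zero_left: "scale 0 f = 0"
  by (intro poly_mapping_eqI) simp

lemma keys_scale: "keys (scale s f) \<subseteq> keys f"
  by (auto simp: in_keys_iff)

lemma keys_diff: "keys (f - g) \<subseteq> keys f \<union> keys (g :: 'a \<Rightarrow>\<^sub>0 'b::ab_group_add)"
  by (auto simp: in_keys_iff lookup_minus)

lemma terms_induct [consumes 1, case_names zero single add]:
  assumes "keys f \<subseteq> S"
    and "X 0" and "\<And>t c. t \<in> S \<Longrightarrow> X (term_of t c)"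
    and "\<And>f g. keys f \<subseteq> S \<Longrightarrow> keys g \<subseteq> S \<Longrightarrow> X f \<Longrightarrow> X g \<Longrightarrow> X (f + g)"
  shows "X (f :: 'a \<Rightarrow>\<^sub>0 'b::ab_group_add)"
  using assms(1)
proof (induction "card (keys f)" arbitrary: f)
  case 0
  then have "f = 0"
    by (simp)
  with assms(2) show ?case
    by simp
next
  case (Suc n)
  then obtain t where t: "t \<in> keys f"
    by (metis card.empty ex_in_conv nat.distinct(1))
  let ?g = "f - term_of t (coeff_at f t)"
  have k: "keys ?g = keys f - {t}"
    using t by (auto simp: in_keys_iff lookup_minus lookup_single when_def split: if_splits)
  have "X ?g"
    using Suc t k by (intro Suc.hyps) (auto simp: card_Diff_singleton)
  moreover have "X (term_of t (coeff_at f t))"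
    using Suc.prems t by (intro assms(3)) auto
  ultimately have "X (term_of t (coeff_at f t) + ?g)"
    using Suc.prems k t by (intro assms(4)) auto
  then show ?case
    by simp
qed

section \<open>The multiplication of a path algebra\<close>

text \<open>
  The formula for the product in \<^const>\<open>path_algebra\<close>, read on all finitely supported functions on
  triples. It is bilinear and associative there, so computations need no side conditions; only the
  unit requires the triples to be paths.
\<close>

definition path_mult ::
  "(('v, 'e) path \<Rightarrow>\<^sub>0 'k) \<Rightarrow> (('v, 'e) path \<Rightarrow>\<^sub>0 'k) \<Rightarrow> ('v, 'e) path \<Rightarrow>\<^sub>0 'k::field" (infixl "\<star>" 70)
  where "f \<star> g = (\<Sum>p\<in>keys f. \<Sum>q\<in>keys g. scale (coeff_at f p * coeff_at g q) (path_prod p q))"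

lemma path_mult_superset:
  assumes "keys f \<subseteq> S" "keys g \<subseteq> T" "finite S" "finite T"
  shows "f \<star> g = (\<Sum>p\<in>S. \<Sum>q\<in>T. scale (coeff_at f p * coeff_at g q) (path_prod p q))"
proof -
  note z = scale_zero_left
  have "f \<star> g = (\<Sum>p\<in>keys f. \<Sum>q\<in>T. scale (coeff_at f p * coeff_at g q) (path_prod p q))"
    unfolding path_mult_def using assms
    by (intro sum.cong refl sum.mono_neutral_left) (auto simp: in_keys_iff z)
  also have "\<dots> = (\<Sum>p\<in>S. \<Sum>q\<in>T. scale (coeff_at f p * coeff_at g q) (path_prod p q))"
    using assms by (intro sum.mono_neutral_left) (auto simp: in_keys_iff z)
  finally show ?thesis .
qed

lemma scale_add_left: "scale (s + t) f = scale s f + scale t f"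
  by (intro poly_mapping_eqI) (simp add: lookup_add distrib_right)

lemma path_mult_add_left: "(f + f') \<star> g = f \<star> g + f' \<star> g"
proof -
  let ?S = "keys f \<union> keys f'"
  have "keys (f + f') \<subseteq> ?S"
    by (rule keys_add)
  then show ?thesis
    by (simp add: path_mult_superset[of _ ?S g "keys g"] lookup_add distrib_right
        scale_add_left sum.distrib)
qed

lemma path_mult_add_right: "f \<star> (g + g') = f \<star> g + f \<star> g'"
proof -
  let ?S = "keys g \<union> keys g'"
  have "keys (g + g') \<subseteq> ?S"
    by (rule keys_add)
  then show ?thesis
    by (simp add: path_mult_superset[of f "keys f" _ ?S] lookup_add distrib_left
        scale_add_left sum.distrib)
qed

lemma path_mult_zero [simp]: "0 \<star> g = 0" "f \<star> 0 = 0"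
  by (simp_all add: path_mult_def)

lemma path_mult_uminus: "(- f) \<star> g = - (f \<star> g)" "f \<star> (- g) = - (f \<star> g)"
  using path_mult_add_left[of f "- f" g] path_mult_add_right[of f g "- g"]
  by (simp_all add: eq_neg_iff_add_eq_0 add.commute)

lemma path_mult_diff_left: "(f - f') \<star> g = f \<star> g - f' \<star> g"
  using path_mult_add_left[of f "- f'" g] by (simp add: path_mult_uminus)

lemma path_mult_diff_right: "f \<star> (g - g') = f \<star> g - f \<star> g'"
  using path_mult_add_right[of f g "- g'"] by (simp add: path_mult_uminus)

lemma path_mult_sum_left: "(\<Sum>i\<in>S. h i) \<star> g = (\<Sum>i\<in>S. h i \<star> g)"
  by (induction S rule: infinite_finite_induct) (auto simp: path_mult_add_left)

lemma path_mult_sum_right: "g \<star> (\<Sum>i\<in>S. h i) = (\<Sum>i\<in>S. g \<star> h i)"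
  by (induction S rule: infinite_finite_induct) (auto simp: path_mult_add_right)

lemma term_mult_term:
  "term_of (u, p, v) a \<star> term_of (v', q, w) b = (if v = v' then term_of (u, p @ q, w) (a * b) else 0)"
proof -
  have "term_of (u, p, v) a \<star> term_of (v', q, w) b
      = (\<Sum>s\<in>{(u, p, v)}. \<Sum>t\<in>{(v', q, w)}.
          scale (coeff_at (term_of (u, p, v) a) s * coeff_at (term_of (v', q, w) b) t) (path_prod s t))"
    by (rule path_mult_superset) simp_all
  also have "\<dots> = scale (a * b) (path_prod (u, p, v) (v', q, w))"
    by (simp del: path_prod.simps)
  also have "\<dots> = (if v = v' then term_of (u, p @ q, w) (a * b) else 0)"
    by (intro poly_mapping_eqI) (simp add: lookup_single when_def)
  finally show ?thesis .
qed

lemma path_mult_assoc: "(f \<star> g) \<star> h = f \<star> (g \<star> h)"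
proof -
  have "keys f \<subseteq> UNIV" "keys g \<subseteq> UNIV" "keys h \<subseteq> UNIV"
    by auto
  then show ?thesis
  proof (induction f rule: terms_induct)
    case (single s a)
    from single(2,3) show ?case
    proof (induction g rule: terms_induct)
      case (single t b)
      from single(2) show ?case
      proof (induction h rule: terms_induct)
        case (single x c)
        show ?case
          by (cases s; cases t; cases x) (auto simp: term_mult_term mult.assoc)
      qed (auto simp: path_mult_add_right)
    qed (auto simp: path_mult_add_left path_mult_add_right)
  qed (auto simp: path_mult_add_left)
qed

lemma scale_path_mult: "scale s f \<star> g = scale s (f \<star> g)" "f \<star> scale s g = scale s (f \<star> g)"
proof -
  have "keys f \<subseteq> UNIV" "keys g \<subseteq> UNIV"
    by auto
  then have "scale s f \<star> g = scale s (f \<star> g) \<and> f \<star> scale s g = scale s (f \<star> g)"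
  proof (induction f rule: terms_induct)
    case (single t a)
    from single(2) show ?case
    proof (induction g rule: terms_induct)
      case (single x b)
      show ?case
        by (cases t; cases x) (simp add: term_mult_term mult.left_commute mult.assoc)
    qed (auto simp: path_mult_add_right scale_add)
  qed (auto simp: path_mult_add_left scale_add)
  then show "scale s f \<star> g = scale s (f \<star> g)" "f \<star> scale s g = scale s (f \<star> g)"
    by auto
qed

definition degree_part :: "nat \<Rightarrow> (('v, 'e) path \<Rightarrow>\<^sub>0 'k::field) \<Rightarrow> ('v, 'e) path \<Rightarrow>\<^sub>0 'k" where
  "degree_part n = Poly_Mapping.mapp (\<lambda>t c. if path_length t = n then c else 0)"

lemma lookup_degree_part [simp]:
  "coeff_at (degree_part n f) t = (if path_length t = n then coeff_at f t else 0)"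
  by (simp add: degree_part_def lookup_mapp in_keys_iff when_def)

lemma degree_part_add: "degree_part n (f + g) = degree_part n f + degree_part n g"
  by (intro poly_mapping_eqI) (simp add: lookup_add)

lemma degree_part_diff: "degree_part n (f - g) = degree_part n f - degree_part n g"
  by (intro poly_mapping_eqI) (simp add: lookup_minus)

lemma degree_part_scale: "degree_part n (scale s f) = scale s (degree_part n f)"
  by (intro poly_mapping_eqI) simp

lemma degree_part_zero [simp]: "degree_part n 0 = 0"
  by (intro poly_mapping_eqI) simp

lemma degree_part_sum: "degree_part n (\<Sum>i\<in>S. h i) = (\<Sum>i\<in>S. degree_part n (h i))"
  by (induction S rule: infinite_finite_induct) (auto simp: degree_part_add)

lemma degree_part_term:
  "degree_part n (term_of t c) = (if path_length t = n then term_of t c else 0)"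
  by (intro poly_mapping_eqI) (auto simp: lookup_single when_def)

lemma degree_part_degree_part:
  "degree_part n (degree_part m f) = (if n = m then degree_part m f else 0)"
  by (intro poly_mapping_eqI) auto

lemma degree_part_mult:
  "degree_part n (f \<star> g) = (\<Sum>i\<le>n. degree_part i f \<star> degree_part (n - i) g)"
proof -
  have "keys f \<subseteq> UNIV" "keys g \<subseteq> UNIV"
    by auto
  then show ?thesis
  proof (induction f rule: terms_induct)
    case (single s a)
    from single(2) show ?case
    proof (induction g rule: terms_induct)
      case (single t b)
      have "(\<Sum>i\<le>n. degree_part i (term_of s a) \<star> degree_part (n - i) (term_of t b))
          = (\<Sum>i\<le>n. if i = path_length s then term_of s a \<star> degree_part (n - i) (term_of t b) else 0)"
        by (intro sum.cong) (auto simp: degree_part_term)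
      also have "\<dots> = degree_part n (term_of s a \<star> term_of t b)"
        by (cases s; cases t) (auto simp: sum.delta degree_part_term term_mult_term)
      finally show ?case ..
    qed (auto simp: path_mult_add_right degree_part_add sum.distrib)
  qed (auto simp: path_mult_add_left degree_part_add sum.distrib)
qed

section \<open>The path algebra of a finite quiver\<close>

text \<open>\<open>P\<close> is a name for the path algebra of \<open>Q\<close>; as a parameter it also fixes the field of scalars.\<close>

locale finite_quiver = wf_digraph Q
  for Q :: "('v, 'e) pre_digraph" +
  fixes P :: "('k::field, ('v, 'e) path \<Rightarrow>\<^sub>0 'k) module"
  assumes finite_verts: "finite (verts Q)"
    and P_def: "P = path_algebra Q"
begin

text \<open>The \<open>n\<close>-th power of the ideal generated by the arrows; \<open>F 0\<close> is the whole path algebra.\<close>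

definition F :: "nat \<Rightarrow> (('v, 'e) path \<Rightarrow>\<^sub>0 'k) set" where
  "F n = {f. keys f \<subseteq> {t \<in> paths Q. n \<le> path_length t}}"

definition path_one :: "('v, 'e) path \<Rightarrow>\<^sub>0 'k" where
  "path_one = (\<Sum>v\<in>verts Q. term_of (v, [], v) 1)"

lemma P_simps [simp]:
  "carrier P = F 0" "f \<otimes>\<^bsub>P\<^esub> g = f \<star> g" "\<one>\<^bsub>P\<^esub> = path_one" "\<zero>\<^bsub>P\<^esub> = 0" "f \<oplus>\<^bsub>P\<^esub> g = f + g"
  "s \<odot>\<^bsub>P\<^esub> f = scale s f"
  by (auto simp: P_def path_algebra_def F_def path_mult_def path_one_def)

lemma F_zero [simp]: "0 \<in> F n"
  by (simp add: F_def)

lemma F_add: "f \<in> F n \<Longrightarrow> g \<in> F n \<Longrightarrow> f + g \<in> F n"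
  unfolding F_def using keys_add[of f g] by blast

lemma F_diff: "f \<in> F n \<Longrightarrow> g \<in> F n \<Longrightarrow> f - g \<in> F n"
  unfolding F_def using keys_diff[of f g] by blast

lemma F_uminus: "f \<in> F n \<Longrightarrow> - f \<in> F n"
  using F_diff[of 0 n f] by simp

lemma F_scale: "f \<in> F n \<Longrightarrow> scale s f \<in> F n"
  unfolding F_def using keys_scale[of s f] by blast

lemma F_mono: "m \<le> n \<Longrightarrow> F n \<subseteq> F m"
  by (auto simp: F_def)

lemma F_sum: "(\<And>i. i \<in> S \<Longrightarrow> h i \<in> F n) \<Longrightarrow> (\<Sum>i\<in>S. h i) \<in> F n"
  by (induction S rule: infinite_finite_induct) (auto intro: F_add)

lemma F_term: "t \<in> paths Q \<Longrightarrow> n \<le> path_length t \<Longrightarrow> term_of t c \<in> F n"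
  by (auto simp: F_def)

lemma F_induct [consumes 1, case_names zero single add]:
  assumes "f \<in> F n" "X 0"
    and "\<And>t c. t \<in> paths Q \<Longrightarrow> n \<le> path_length t \<Longrightarrow> X (term_of t c)"
    and "\<And>f g. f \<in> F n \<Longrightarrow> g \<in> F n \<Longrightarrow> X f \<Longrightarrow> X g \<Longrightarrow> X (f + g)"
  shows "X f"
proof -
  have "keys f \<subseteq> {t \<in> paths Q. n \<le> path_length t}"
    using assms(1) by (simp add: F_def)
  then show ?thesis
    by (induction rule: terms_induct) (use assms in \<open>auto simp: F_def\<close>)
qed

lemma paths_append:
  "(u, p, v) \<in> paths Q \<Longrightarrow> (v, q, w) \<in> paths Q \<Longrightarrow> (u, p @ q, w) \<in> paths Q"
  by (auto simp: paths_def)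

lemma paths_split:
  assumes "(u, p @ q, w) \<in> paths Q"
  obtains v where "(u, p, v) \<in> paths Q" "(v, q, w) \<in> paths Q"
  using assms by (auto simp: paths_def)

lemma F_mult:
  assumes "f \<in> F m" "g \<in> F n"
  shows "f \<star> g \<in> F (m + n)"
  using assms
proof (induction f rule: F_induct)
  case (single s a)
  note s = this
  from single(3) show ?case
  proof (induction g rule: F_induct)
    case (single t b)
    with s show ?case
      by (cases s; cases t) (auto simp: term_mult_term intro!: F_term intro: paths_append)
  qed (auto simp: path_mult_add_right intro: F_add)
qed (auto simp: path_mult_add_left intro: F_add)

lemma F_mult0: "f \<in> F 0 \<Longrightarrow> g \<in> F n \<Longrightarrow> f \<star> g \<in> F n" "f \<in> F n \<Longrightarrow> g \<in> F 0 \<Longrightarrow> f \<star> g \<in> F n"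
  using F_mult[of f 0 g n] F_mult[of f n g 0] by auto

text \<open>
  Cutting a path of length at least \<open>m + n\<close> after its first \<open>m\<close> arrows shows that \<open>F (m + n)\<close> is
  additively generated by the products of elements of \<open>F m\<close> and \<open>F n\<close>.
\<close>

lemma F_mult_induct [consumes 1, case_names zero mult add]:
  assumes "f \<in> F (m + n)" "X 0"
    and "\<And>f g. f \<in> F m \<Longrightarrow> g \<in> F n \<Longrightarrow> X (f \<star> g)"
    and "\<And>f g. f \<in> F (m + n) \<Longrightarrow> g \<in> F (m + n) \<Longrightarrow> X f \<Longrightarrow> X g \<Longrightarrow> X (f + g)"
  shows "X f"
  using assms(1)
proof (induction rule: F_induct)
  case (single t c)
  obtain u p w where t: "t = (u, p, w)"
    by (cases t)
  with single have "(u, take m p @ drop m p, w) \<in> paths Q"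
    by simp
  then obtain v where v: "(u, take m p, v) \<in> paths Q" "(v, drop m p, w) \<in> paths Q"
    by (rule paths_split)
  have "term_of t c = term_of (u, take m p, v) c \<star> term_of (v, drop m p, w) 1"
    by (simp add: t term_mult_term)
  moreover have "X (term_of (u, take m p, v) c \<star> term_of (v, drop m p, w) 1)"
    using single t v by (intro assms(3) F_term) auto
  ultimately show ?case
    by simp
qed (use assms in auto)

lemma path_one_in_F: "path_one \<in> F 0"
  unfolding path_one_def by (intro F_sum F_term) (auto simp: paths_def awalk_Nil_iff)

lemma path_one_mult:
  assumes "f \<in> F 0"
  shows "path_one \<star> f = f" "f \<star> path_one = f"
proof -
  have "path_one \<star> f = f \<and> f \<star> path_one = f"
    using assms
  proof (induction f rule: F_induct)
    case (single t c)
    obtain u p w where t: "t = (u, p, w)"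
      by (cases t)
    with single have "u \<in> verts Q" "w \<in> verts Q"
      by (auto simp: paths_def)
    then show ?case
      using finite_verts
      by (simp add: t path_one_def path_mult_sum_left path_mult_sum_right term_mult_term
          if_distrib sum.delta' cong: if_cong)
  qed (auto simp: path_mult_add_right path_mult_add_left)
  then show "path_one \<star> f = f" "f \<star> path_one = f"
    by auto
qed

lemma ring_P: "ring P"
proof (intro ringI abelian_groupI monoidI)
  fix x assume "x \<in> carrier P"
  then show "\<exists>y\<in>carrier P. y \<oplus>\<^bsub>P\<^esub> x = \<zero>\<^bsub>P\<^esub>"
    by (intro bexI[of _ "- x"]) (auto intro: F_uminus)
qed (auto intro: F_add F_mult0 path_one_in_F
    simp: path_one_mult path_mult_assoc path_mult_add_left path_mult_add_right add.commute add.assoc)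

sublocale ring P
  by (rule ring_P)

lemma a_inv_P: "f \<in> F 0 \<Longrightarrow> \<ominus>\<^bsub>P\<^esub> f = - f"
  by (rule minus_equality) (auto intro: F_uminus)

lemma P_idealI:
  assumes "K \<subseteq> F 0" "0 \<in> K" "\<And>f g. f \<in> K \<Longrightarrow> g \<in> K \<Longrightarrow> f - g \<in> K"
    and "\<And>f g. f \<in> K \<Longrightarrow> g \<in> F 0 \<Longrightarrow> f \<star> g \<in> K" "\<And>f g. f \<in> K \<Longrightarrow> g \<in> F 0 \<Longrightarrow> g \<star> f \<in> K"
  shows "ideal K P"
proof (intro idealI ring_P)
  have um: "- f \<in> K" if "f \<in> K" for f
    using assms(3)[OF assms(2) that] by simp
  have "f + g \<in> K" if "f \<in> K" "g \<in> K" for f g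
    using assms(3)[OF that(1) um[OF that(2)]] by simp
  then show "subgroup K (add_monoid P)"
    using assms um by (intro add.subgroupI) (auto simp: a_inv_P simp flip: a_inv_def)
qed (use assms in auto)

lemma ideal_F: "ideal (F n) P"
  by (intro P_idealI) (use F_mono[of 0 n] in \<open>auto intro: F_diff F_mult0\<close>)

definition vertex_coeff :: "'v \<Rightarrow> (('v, 'e) path \<Rightarrow>\<^sub>0 'k) \<Rightarrow> 'k" where
  "vertex_coeff v f = coeff_at f (v, [], v)"

text \<open>
  A trivial path is a product of two paths only if both factors are trivial. So taking the
  coefficient at a vertex is multiplicative: these are the simple modules of the path algebra on
  which the arrows act by zero.
\<close>

lemma vertex_coeff_mult:
  assumes "f \<in> F 0" "g \<in> F 0"
  shows "vertex_coeff v (f \<star> g) = vertex_coeff v f * vertex_coeff v g"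
  using assms
proof (induction f rule: F_induct)
  case (single s a)
  note s = this
  from single(3) show ?case
  proof (induction g rule: F_induct)
    case (single t b)
    with s show ?case
      by (cases s; cases t)
        (auto simp: term_mult_term vertex_coeff_def lookup_single when_def paths_def awalk_Nil_iff)
  qed (auto simp: path_mult_add_right vertex_coeff_def lookup_add algebra_simps)
qed (auto simp: path_mult_add_left vertex_coeff_def lookup_add algebra_simps)

lemma vertex_coeff_one: "v \<in> verts Q \<Longrightarrow> vertex_coeff v path_one = 1"
  using finite_verts
  by (simp add: vertex_coeff_def path_one_def lookup_sum lookup_single when_def sum.delta)

lemma F_Suc_0_iff: "f \<in> F (Suc 0) \<longleftrightarrow> f \<in> F 0 \<and> (\<forall>v\<in>verts Q. vertex_coeff v f = 0)"
proof (intro iffI conjI ballI)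
  assume f: "f \<in> F 0 \<and> (\<forall>v\<in>verts Q. vertex_coeff v f = 0)"
  show "f \<in> F (Suc 0)"
    unfolding F_def
  proof safe
    fix u p v assume k: "(u, p, v) \<in> keys f"
    with f show uv: "(u, p, v) \<in> paths Q"
      by (auto simp: F_def)
    have "p \<noteq> []"
    proof
      assume "p = []"
      with uv have "u = v" "v \<in> verts Q"
        by (auto simp: paths_def awalk_Nil_iff)
      with f k \<open>p = []\<close> show False
        by (auto simp: vertex_coeff_def in_keys_iff)
    qed
    then show "Suc 0 \<le> path_length (u, p, v)"
      by (cases p) auto
  qed
next
  assume f: "f \<in> F (Suc 0)"
  then show "f \<in> F 0"
    using F_mono[of 0 "Suc 0"] by auto
  show "vertex_coeff v f = 0" for v
  proof (rule ccontr)
    assume "vertex_coeff v f \<noteq> 0"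
    then have "(v, [], v) \<in> keys f"
      by (simp add: vertex_coeff_def in_keys_iff)
    with f show False
      by (auto simp: F_def)
  qed
qed

lemma degree_part_in_F:
  assumes "f \<in> F m"
  shows "degree_part n f \<in> F n" "degree_part n f \<in> F m"
proof -
  have "keys (degree_part n f) \<subseteq> {t \<in> keys f. path_length t = n}"
    by (auto simp: in_keys_iff split: if_splits)
  then show "degree_part n f \<in> F n" "degree_part n f \<in> F m"
    using assms by (auto simp: F_def)
qed

lemma degree_part_F_eq_0:
  assumes "f \<in> F m" "n < m"
  shows "degree_part n f = 0"
proof (intro poly_mapping_eqI)
  fix t
  have "coeff_at f t = 0" if "path_length t = n"
    using assms that by (auto simp: F_def in_keys_iff)
  then show "coeff_at (degree_part n f) t = coeff_at 0 t"
    by simp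
qed

lemma diff_degree_part_in_F:
  assumes "f \<in> F n"
  shows "f - degree_part n f \<in> F (Suc n)"
proof -
  have "t \<in> paths Q \<and> n < path_length t" if "t \<in> keys (f - degree_part n f)" for t
  proof -
    from that have "t \<in> keys f" "path_length t \<noteq> n"
      by (auto simp: in_keys_iff lookup_minus split: if_splits)
    with assms show ?thesis
      by (auto simp: F_def)
  qed
  then show ?thesis
    by (force simp: F_def)
qed

lemma sum_degree_part:
  assumes "f \<in> F 0"
  shows "f - (\<Sum>i<n. degree_part i f) \<in> F n"
proof -
  have "t \<in> paths Q \<and> n \<le> path_length t" if t: "t \<in> keys (f - (\<Sum>i<n. degree_part i f))" for t
  proof -
    have "coeff_at (\<Sum>i<n. degree_part i f) t = (if path_length t < n then coeff_at f t else 0)"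
      by (simp add: lookup_sum sum.delta)
    with t have "t \<in> keys f" "n \<le> path_length t"
      by (auto simp: in_keys_iff lookup_minus split: if_splits)
    with assms show ?thesis
      by (auto simp: F_def)
  qed
  then show ?thesis
    by (force simp: F_def)
qed

end

lemma ring_cong:
  assumes "ring R" "carrier S = carrier R" "mult S = mult R" "one S = one R" "zero S = zero R" "add S = add R"
  shows "ring S"
proof -
  interpret R: ring R
    by fact
  show ?thesis
  proof (intro ringI abelian_groupI monoidI)
    fix x assume "x \<in> carrier S"
    then show "\<exists>y\<in>carrier S. y \<oplus>\<^bsub>S\<^esub> x = \<zero>\<^bsub>S\<^esub>"
      using assms(2-) R.l_neg by (metis R.a_inv_closed)
  qed (use assms(2-) in \<open>auto simp: R.m_assoc R.a_ac R.l_distr R.r_distr\<close>)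
qed

section \<open>Quotients with nilpotent arrow ideal\<close>

locale path_algebra_ideal = finite_quiver Q P
  for Q :: "('v, 'e) pre_digraph" and P :: "('k::field, ('v, 'e) path \<Rightarrow>\<^sub>0 'k) module" +
  fixes I :: "(('v, 'e) path \<Rightarrow>\<^sub>0 'k) set"
  assumes ideal_I: "ideal I P"
begin

sublocale II: ideal I P
  by (rule ideal_I)

lemma I_F0: "f \<in> I \<Longrightarrow> f \<in> F 0"
  using II.Icarr by simp

lemma I_zero [simp]: "0 \<in> I"
  using II.zero_closed by simp

lemma I_add: "f \<in> I \<Longrightarrow> g \<in> I \<Longrightarrow> f + g \<in> I"
  using II.a_closed[of f g] by simp

lemma I_uminus: "f \<in> I \<Longrightarrow> - f \<in> I"
  using II.a_inv_closed[of f] by (simp add: a_inv_P I_F0)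

lemma I_diff: "f \<in> I \<Longrightarrow> g \<in> I \<Longrightarrow> f - g \<in> I"
  using I_add[of f "- g"] I_uminus[of g] by simp

lemma I_mult: "f \<in> I \<Longrightarrow> g \<in> F 0 \<Longrightarrow> f \<star> g \<in> I" "f \<in> I \<Longrightarrow> g \<in> F 0 \<Longrightarrow> g \<star> f \<in> I"
  using II.I_r_closed[of f g] II.I_l_closed[of f g] by simp_all

lemma I_scale: "f \<in> I \<Longrightarrow> scale s f \<in> I"
  using I_mult(1)[of f "scale s path_one"]
  by (simp add: scale_path_mult path_one_mult I_F0 F_scale path_one_in_F)

end

text \<open>
  The condition \<open>I \<subseteq> F (Suc 0)\<close> lets the coefficients at the vertices descend to the quotient \<open>A\<close>, and
  \<open>F m \<subseteq> I\<close> makes the image of the arrow ideal nilpotent. Together they determine the radical of \<open>A\<close>.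
\<close>

locale nilpotent_quotient = path_algebra_ideal Q P I
  for Q :: "('v, 'e) pre_digraph" and P :: "('k::field, ('v, 'e) path \<Rightarrow>\<^sub>0 'k) module"
    and I :: "(('v, 'e) path \<Rightarrow>\<^sub>0 'k) set" +
  fixes A :: "('k, (('v, 'e) path \<Rightarrow>\<^sub>0 'k) set) module"
  assumes I_subset: "I \<subseteq> F (Suc 0)"
    and ex_F_subset_I: "\<exists>m. F m \<subseteq> I"
    and A_def: "A = quotient_algebra P I"
begin

definition cls :: "(('v, 'e) path \<Rightarrow>\<^sub>0 'k) \<Rightarrow> (('v, 'e) path \<Rightarrow>\<^sub>0 'k) set" where
  "cls f = I +>\<^bsub>P\<^esub> f"

lemma cls_eq: "cls f = (\<lambda>h. h + f) ` I"
  by (auto simp: cls_def a_r_coset_def')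

lemma mem_cls: "g \<in> cls f \<longleftrightarrow> g - f \<in> I"
  unfolding cls_eq by (force simp: image_iff)

lemma cls_eq_iff: "cls f = cls g \<longleftrightarrow> f - g \<in> I"
proof
  assume "cls f = cls g"
  then show "f - g \<in> I"
    using mem_cls[of f f] mem_cls[of f g] by simp
next
  assume fg: "f - g \<in> I"
  have "h - f \<in> I \<longleftrightarrow> h - g \<in> I" for h
    using I_add[of "h - f" "f - g"] I_diff[of "h - g" "f - g"] fg by auto
  then show "cls f = cls g"
    by (auto simp: mem_cls)
qed

lemma cls_zero: "cls 0 = I"
  by (auto simp: mem_cls)

lemma A_fields:
  "carrier A = cls ` F 0" "mult A = rcoset_mult P I" "add A = set_add P" "\<one>\<^bsub>A\<^esub> = cls path_one"
  "\<zero>\<^bsub>A\<^esub> = cls 0" "smult A = coset_smult P I"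
proof -
  show "\<zero>\<^bsub>A\<^esub> = cls 0"
    by (simp add: A_def quotient_algebra_def ring.extend_def module.fields_def FactRing_def cls_zero)
qed (auto simp: A_def quotient_algebra_def ring.extend_def module.fields_def FactRing_def
    A_RCOSETS_def' cls_def)

lemma ring_A: "ring A"
  by (rule ring_cong[OF II.quotient_is_ring])
    (simp_all add: A_def quotient_algebra_def ring.extend_def module.fields_def)

sublocale A: ring A
  by (rule ring_A)

lemma A_simps [simp]:
  assumes "f \<in> F 0" "g \<in> F 0"
  shows "cls f \<otimes>\<^bsub>A\<^esub> cls g = cls (f \<star> g)" "cls f \<oplus>\<^bsub>A\<^esub> cls g = cls (f + g)"
  using assms II.rcoset_mult_add[of f g] II.a_rcos_sum[of f g] by (simp_all add: A_fields cls_def)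

lemma A_smult:
  assumes "f \<in> F 0"
  shows "s \<odot>\<^bsub>A\<^esub> cls f = cls (scale s f)"
proof -
  have "I +>\<^bsub>P\<^esub> (s \<odot>\<^bsub>P\<^esub> x) = cls (scale s f)" if "x \<in> cls f" for x
    using that I_scale[of "x - f" s]
    by (simp add: mem_cls cls_eq_iff scale_diff flip: cls_def)
  moreover have "cls f \<noteq> {}"
    using mem_cls[of f f] by auto
  ultimately show ?thesis
    by (auto simp: A_fields coset_smult_def)
qed

lemma A_uminus [simp]:
  assumes "f \<in> F 0"
  shows "\<ominus>\<^bsub>A\<^esub> cls f = cls (- f)"
  using assms by (intro A.minus_equality) (auto simp: A_fields(1,5) F_uminus)

lemma A_minus [simp]: "f \<in> F 0 \<Longrightarrow> g \<in> F 0 \<Longrightarrow> cls f \<ominus>\<^bsub>A\<^esub> cls g = cls (f - g)"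
  by (simp add: a_minus_def F_uminus)

lemma cls_in_A: "f \<in> F 0 \<Longrightarrow> cls f \<in> carrier A"
  by (simp add: A_fields)

lemma F_F0: "f \<in> F n \<Longrightarrow> f \<in> F 0"
  using F_mono[of 0 n] by auto

text \<open>
  The sum of \<open>F n\<close> and \<open>I\<close>, which is the preimage in the path algebra of the \<open>n\<close>-th power of the
  radical of \<open>A\<close>. It allows all statements about cosets to be expressed by representatives.
\<close>

definition K :: "nat \<Rightarrow> (('v, 'e) path \<Rightarrow>\<^sub>0 'k) set" where
  "K n = {f. \<exists>g\<in>F n. f - g \<in> I}"

lemma F_subset_K: "f \<in> F n \<Longrightarrow> f \<in> K n"
  by (force simp: K_def)

lemma I_subset_K: "f \<in> I \<Longrightarrow> f \<in> K n"
  by (auto simp: K_def intro: bexI[of _ 0])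

lemma K_F0: "f \<in> K n \<Longrightarrow> f \<in> F 0"
proof -
  assume "f \<in> K n"
  then obtain g where "g \<in> F n" "f - g \<in> I"
    by (auto simp: K_def)
  then have "(f - g) + g \<in> F 0"
    by (intro F_add) (auto intro: I_F0 F_F0)
  then show ?thesis
    by simp
qed

lemma K_add: "f \<in> K n \<Longrightarrow> g \<in> K n \<Longrightarrow> f + g \<in> K n"
proof -
  assume "f \<in> K n" "g \<in> K n"
  then obtain f' g' where *: "f' \<in> F n" "f - f' \<in> I" "g' \<in> F n" "g - g' \<in> I"
    by (auto simp: K_def)
  have "f + g - (f' + g') = (f - f') + (g - g')"
    by simp
  with * have "f + g - (f' + g') \<in> I" "f' + g' \<in> F n"
    by (simp_all only: I_add F_add)
  then show ?thesis
    unfolding K_def by blast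
qed

lemma K_scale: "f \<in> K n \<Longrightarrow> scale s f \<in> K n"
proof -
  assume "f \<in> K n"
  then obtain f' where "f' \<in> F n" "f - f' \<in> I"
    by (auto simp: K_def)
  then have "scale s f' \<in> F n" "scale s f - scale s f' \<in> I"
    using I_scale[of "f - f'" s] by (auto simp: F_scale scale_diff)
  then show ?thesis
    unfolding K_def by blast
qed

lemma K_zero [simp]: "0 \<in> K n"
  by (simp add: F_subset_K)

lemma K_uminus: "f \<in> K n \<Longrightarrow> - f \<in> K n"
proof -
  have "scale (- 1) f = - f"
    by (intro poly_mapping_eqI) simp
  then show "f \<in> K n \<Longrightarrow> - f \<in> K n"
    using K_scale[of f n "- 1"] by simp
qed

lemma K_diff: "f \<in> K n \<Longrightarrow> g \<in> K n \<Longrightarrow> f - g \<in> K n"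
  using K_add[of f n "- g"] K_uminus[of g n] by simp

lemma K_sum: "(\<And>i. i \<in> S \<Longrightarrow> h i \<in> K n) \<Longrightarrow> (\<Sum>i\<in>S. h i) \<in> K n"
  by (induction S rule: infinite_finite_induct) (auto intro: K_add)

lemma K_mono: "m \<le> n \<Longrightarrow> K n \<subseteq> K m"
  using F_mono[of m n] by (auto simp: K_def)

lemma K_mult:
  assumes "f \<in> K m" "g \<in> K n"
  shows "f \<star> g \<in> K (m + n)"
proof -
  obtain f' g' where *: "f' \<in> F m" "f - f' \<in> I" "g' \<in> F n" "g - g' \<in> I"
    using assms by (auto simp: K_def)
  have "f \<star> g - f' \<star> g' = (f - f') \<star> g + f' \<star> (g - g')"
    by (simp add: path_mult_diff_left path_mult_diff_right)
  also have "\<dots> \<in> I"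
    using * assms by (intro I_add I_mult) (auto intro: K_F0 F_F0)
  finally show ?thesis
    using F_mult[OF *(1,3)] unfolding K_def by blast
qed

text \<open>This is what makes the multiplication of the associated graded algebra well defined.\<close>

lemma K_mult_add:
  assumes "f - f' \<in> K (Suc m)" "g - g' \<in> K (Suc n)" "f \<in> K m" "g' \<in> K n"
  shows "f \<star> g - f' \<star> g' \<in> K (Suc (m + n))"
proof -
  have "f \<star> g - f' \<star> g' = f \<star> (g - g') + (f - f') \<star> g'"
    by (simp add: path_mult_diff_left path_mult_diff_right)
  also have "\<dots> \<in> K (Suc (m + n))"
    using K_mult[OF assms(3,2)] K_mult[OF assms(1,4)] by (intro K_add) auto
  finally show ?thesis .
qed

lemma K_Suc_0: "K (Suc 0) = F (Suc 0)"
proof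
  show "K (Suc 0) \<subseteq> F (Suc 0)"
  proof
    fix f assume "f \<in> K (Suc 0)"
    then obtain g where "g \<in> F (Suc 0)" "f - g \<in> I"
      by (auto simp: K_def)
    then have "(f - g) + g \<in> F (Suc 0)"
      using I_subset by (intro F_add) auto
    then show "f \<in> F (Suc 0)"
      by simp
  qed
qed (auto intro: F_subset_K)

lemma cls_in_cls_F: "f \<in> F 0 \<Longrightarrow> cls f \<in> cls ` F n \<longleftrightarrow> f \<in> K n"
  by (auto simp: K_def image_iff cls_eq_iff)

lemma ideal_cls_F: "ideal (cls ` F n) A"
proof (intro idealI ring_A)
  show "subgroup (cls ` F n) (add_monoid A)"
  proof (intro A.add.subgroupI)
    show "cls ` F n \<subseteq> carrier A"
      by (auto simp: A_fields F_F0)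
    show "cls ` F n \<noteq> {}"
      using F_zero by blast
  qed (auto simp: F_F0 F_add F_uminus simp flip: a_inv_def)
qed (auto simp: A_fields(1) F_F0 F_mult0 intro!: imageI)

lemma ideal_power_cls_F: "ideal_power A (cls ` F (Suc 0)) n = cls ` F n"
proof (induction n)
  case 0
  show ?case
    by (simp add: A_fields)
next
  case (Suc n)
  have "x \<in> cls ` F (Suc n)" if "x \<in> ideal_prod A (cls ` F n) (cls ` F (Suc 0))" for x
    using that
  proof induction
    case (prod i j)
    then show ?case
      using F_mult[of _ n _ "Suc 0"] by (auto simp: F_F0 intro!: imageI)
  next
    case (sum s t)
    then show ?case
      by (auto simp: F_F0 F_add intro!: imageI)
  qed
  moreover have "cls f \<in> ideal_prod A (cls ` F n) (cls ` F (Suc 0))" if "f \<in> F (Suc n)" for f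
  proof -
    from that have "f \<in> F (n + Suc 0)"
      by simp
    then show ?thesis
    proof (induction rule: F_mult_induct)
      case zero
      show ?case
        using ideal_prod.prod[of "cls 0" "cls ` F n" "cls 0" "cls ` F (Suc 0)" A] by simp
    next
      case (mult f g)
      then show ?case
        using ideal_prod.prod[of "cls f" "cls ` F n" "cls g" "cls ` F (Suc 0)" A]
        by (simp add: F_F0)
    next
      case (add f g)
      then show ?case
        using ideal_prod.sum[of "cls f" A "cls ` F n" "cls ` F (Suc 0)" "cls g"]
        by (simp add: F_F0)
    qed
  qed
  ultimately show ?case
    using Suc by auto
qed

section \<open>The Jacobson radical\<close>

lemma additive_subgroup_A: "additive_subgroup M A \<Longrightarrow> cls 0 \<in> M"
  using additive_subgroup.zero_closed[of M A] by (simp add: A_fields)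

text \<open>
  Let \<open>J\<close> be the image of the arrow ideal. If a maximal right ideal \<open>M\<close> does not contain \<open>J\<close>, then
  \<open>1 = m + j\<close> with \<open>m \<in> M\<close> and \<open>j \<in> J\<close>. Multiplying by \<open>j\<^sup>n\<close> gives \<open>j\<^sup>n = m j\<^sup>n + j\<^sup>n\<^sup>+\<^sup>1\<close>, so \<open>j\<^sup>n\<^sup>+\<^sup>1 \<in> M\<close>
  implies \<open>j\<^sup>n \<in> M\<close>. As \<open>j\<close> is nilpotent, descending to \<open>n = 0\<close> yields \<open>1 \<in> M\<close>, which is absurd.
\<close>

lemma cls_F_subset_maximal:
  assumes M: "maximal_right_ideal M A"
  shows "cls ` F (Suc 0) \<subseteq> M"
proof -
  have sub: "additive_subgroup M A" and r: "\<And>a x. a \<in> M \<Longrightarrow> x \<in> carrier A \<Longrightarrow> a \<otimes>\<^bsub>A\<^esub> x \<in> M"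
    using M by (auto simp: maximal_right_ideal_def right_ideal_def)
  interpret M: additive_subgroup M A
    by fact
  interpret J: ideal "cls ` F (Suc 0)" A
    by (rule ideal_cls_F)
  have addI: "m \<oplus>\<^bsub>A\<^esub> j \<in> M <+>\<^bsub>A\<^esub> cls ` F (Suc 0)" if "m \<in> M" "j \<in> cls ` F (Suc 0)" for m j
    using that unfolding set_add_def' by blast
  let ?N = "M <+>\<^bsub>A\<^esub> cls ` F (Suc 0)"
  have N: "right_ideal ?N A"
    unfolding right_ideal_def
  proof (intro conjI ballI)
    show "additive_subgroup ?N A"
      by (intro A.add_additive_subgroups sub J.additive_subgroup_axioms)
    fix a x assume "a \<in> ?N" "x \<in> carrier A"
    then obtain m j where "m \<in> M" "j \<in> cls ` F (Suc 0)" "a = m \<oplus>\<^bsub>A\<^esub> j"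
      by (auto simp: set_add_def')
    with \<open>x \<in> carrier A\<close> have "a \<otimes>\<^bsub>A\<^esub> x = m \<otimes>\<^bsub>A\<^esub> x \<oplus>\<^bsub>A\<^esub> j \<otimes>\<^bsub>A\<^esub> x"
      "m \<otimes>\<^bsub>A\<^esub> x \<in> M" "j \<otimes>\<^bsub>A\<^esub> x \<in> cls ` F (Suc 0)"
      using r[of m x] J.I_r_closed[of j x] M.a_Hcarr[of m] J.Icarr[of j] by (simp_all add: A.l_distr)
    then show "a \<otimes>\<^bsub>A\<^esub> x \<in> ?N"
      by (simp add: addI)
  qed
  have MN: "M \<subseteq> ?N"
  proof
    fix m assume "m \<in> M"
    then have "m \<in> carrier A" by (rule M.a_Hcarr)
    then have "m \<oplus>\<^bsub>A\<^esub> \<zero>\<^bsub>A\<^esub> = m" by simp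
    with addI[OF \<open>m \<in> M\<close> J.zero_closed] show "m \<in> ?N"
      by simp
  qed
  have JN: "cls ` F (Suc 0) \<subseteq> ?N"
  proof
    fix j assume "j \<in> cls ` F (Suc 0)"
    then have "\<zero>\<^bsub>A\<^esub> \<oplus>\<^bsub>A\<^esub> j = j" using J.Icarr by simp
    with addI[OF M.zero_closed \<open>j \<in> _\<close>] show "j \<in> ?N"
      by simp
  qed
  have "?N \<noteq> carrier A"
  proof
    assume "?N = carrier A"
    then have "\<one>\<^bsub>A\<^esub> \<in> ?N"
      by simp
    then obtain m f where m: "m \<in> M" and f: "f \<in> F (Suc 0)" and one: "\<one>\<^bsub>A\<^esub> = m \<oplus>\<^bsub>A\<^esub> cls f"
      by (auto simp: set_add_def')
    define j where "j = cls f"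
    have j: "j \<in> carrier A" and mc: "m \<in> carrier A"
      using f m M.a_Hcarr by (auto simp: j_def cls_in_A F_F0)
    have pow: "\<exists>g \<in> F n. j [^]\<^bsub>A\<^esub> n = cls g" for n :: nat
    proof (induction n)
      case 0
      then show ?case
        using path_one_in_F by (auto simp: A_fields)
    next
      case (Suc n)
      then obtain g where g: "g \<in> F n" "j [^]\<^bsub>A\<^esub> n = cls g"
        by auto
      then have "g \<star> f \<in> F (Suc n)" "j [^]\<^bsub>A\<^esub> Suc n = cls (g \<star> f)"
        using f F_mult[of g n f "Suc 0"] by (auto simp: j_def F_F0)
      then show ?case
        by blast
    qed
    obtain k where "F k \<subseteq> I"
      using ex_F_subset_I by auto
    moreover obtain g where "g \<in> F k" "j [^]\<^bsub>A\<^esub> k = cls g"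
      using pow by blast
    ultimately have "j [^]\<^bsub>A\<^esub> k = cls 0"
      by (simp add: cls_eq_iff subset_iff)
    then have top: "j [^]\<^bsub>A\<^esub> k \<in> M"
      using additive_subgroup_A[OF sub] by simp
    have down: "j [^]\<^bsub>A\<^esub> n \<in> M" if "j [^]\<^bsub>A\<^esub> Suc n \<in> M" for n :: nat
    proof -
      have "j [^]\<^bsub>A\<^esub> n = (m \<oplus>\<^bsub>A\<^esub> j) \<otimes>\<^bsub>A\<^esub> j [^]\<^bsub>A\<^esub> n"
        using A.l_one[of "j [^]\<^bsub>A\<^esub> n"] one j by (simp flip: j_def)
      also have "\<dots> = m \<otimes>\<^bsub>A\<^esub> j [^]\<^bsub>A\<^esub> n \<oplus>\<^bsub>A\<^esub> j [^]\<^bsub>A\<^esub> Suc n"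
        using j mc by (simp only: A.l_distr A.nat_pow_Suc2 A.nat_pow_closed)
      also have "\<dots> \<in> M"
        using that r[OF m] j by (intro M.a_closed) auto
      finally show ?thesis .
    qed
    have "j [^]\<^bsub>A\<^esub> (k - n) \<in> M" for n
    proof (induction n)
      case (Suc n)
      show ?case
      proof (cases "n < k")
        case True
        then have "Suc (k - Suc n) = k - n"
          by simp
        with Suc down[of "k - Suc n"] show ?thesis
          by simp
      qed (use Suc in simp)
    qed (use top in simp)
    from this[of k] have "\<one>\<^bsub>A\<^esub> \<in> M"
      by simp
    then have "carrier A \<subseteq> M"
      using r[of "\<one>\<^bsub>A\<^esub>"] by force
    then show False
      using M M.a_subset by (auto simp: maximal_right_ideal_def)
  qed
  then have "?N = M"
    using M N MN by (auto simp: maximal_right_ideal_def)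
  with JN show ?thesis
    by simp
qed

lemma vertex_coeff_diff: "vertex_coeff v (f - g) = vertex_coeff v f - vertex_coeff v g"
  by (simp add: vertex_coeff_def lookup_minus)

lemma vertex_coeff_scale: "vertex_coeff v (scale s f) = s * vertex_coeff v f"
  by (simp add: vertex_coeff_def)

lemma vertex_coeff_I: "v \<in> verts Q \<Longrightarrow> f \<in> I \<Longrightarrow> vertex_coeff v f = 0"
  using I_subset F_Suc_0_iff by auto

text \<open>The ideal is the kernel of a homomorphism from \<open>A\<close> onto the field \<open>k\<close>.\<close>

lemma maximal_vertex_ideal:
  assumes v: "v \<in> verts Q"
  shows "maximal_right_ideal (cls ` {f \<in> F 0. vertex_coeff v f = 0}) A" (is "maximal_right_ideal ?M A")
proof -
  have mem: "cls f \<in> ?M \<longleftrightarrow> vertex_coeff v f = 0" if "f \<in> F 0" for f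
  proof
    assume "cls f \<in> ?M"
    then obtain g where "f - g \<in> I" "vertex_coeff v g = 0"
      by (auto simp: cls_eq_iff)
    then show "vertex_coeff v f = 0"
      using vertex_coeff_I[OF v, of "f - g"] by (simp add: vertex_coeff_diff)
  qed (use that in auto)
  have "additive_subgroup ?M A"
    unfolding additive_subgroup_def
  proof (intro A.add.subgroupI)
    show "?M \<subseteq> carrier A"
      by (auto simp: A_fields)
    have "cls 0 \<in> ?M"
      by (auto simp: mem vertex_coeff_def)
    then show "?M \<noteq> {}"
      by blast
  qed (auto simp: mem F_add F_uminus vertex_coeff_def lookup_add simp flip: a_inv_def intro!: imageI)
  moreover have "cls path_one \<notin> ?M"
    using v by (simp add: mem path_one_in_F vertex_coeff_one)
  then have "?M \<noteq> carrier A"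
    using cls_in_A[OF path_one_in_F] by metis
  moreover have "N = ?M \<or> N = carrier A" if N: "right_ideal N A" "?M \<subseteq> N" for N
  proof (rule disjCI)
    assume "N \<noteq> carrier A"
    interpret N: additive_subgroup N A
      using N by (simp add: right_ideal_def)
    have r: "\<And>a x. a \<in> N \<Longrightarrow> x \<in> carrier A \<Longrightarrow> a \<otimes>\<^bsub>A\<^esub> x \<in> N"
      using N by (auto simp: right_ideal_def)
    show "N = ?M"
    proof (rule ccontr)
      assume "N \<noteq> ?M"
      then obtain x where x: "x \<in> N" "x \<notin> ?M"
        using N by auto
      then obtain g where g: "g \<in> F 0" "x = cls g"
        using N.a_Hcarr[of x] by (auto simp: A_fields)
      with x have nz: "vertex_coeff v g \<noteq> 0"
        by (auto simp: mem)
      define h where "h = scale (1 / vertex_coeff v g) path_one"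
      have h: "h \<in> F 0"
        by (simp add: h_def F_scale path_one_in_F)
      have "cls (g \<star> h) \<in> N"
        using r[OF x(1) cls_in_A[OF h]] g h by simp
      moreover have "cls (path_one - g \<star> h) \<in> ?M"
        using g h v nz
        by (subst mem) (auto simp: F_diff F_mult0 path_one_in_F vertex_coeff_diff vertex_coeff_mult
            vertex_coeff_one h_def vertex_coeff_scale)
      then have "cls (path_one - g \<star> h) \<in> N"
        using N by auto
      ultimately have "cls (path_one - g \<star> h) \<oplus>\<^bsub>A\<^esub> cls (g \<star> h) \<in> N"
        by simp
      then have "\<one>\<^bsub>A\<^esub> \<in> N"
        using g h by (simp add: F_diff F_mult0 path_one_in_F A_fields(4))
      then have "carrier A \<subseteq> N"
        using r[of "\<one>\<^bsub>A\<^esub>"] by force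
      with \<open>N \<noteq> carrier A\<close> show False
        using N.a_subset by auto
    qed
  qed
  moreover have "\<forall>a\<in>?M. \<forall>x\<in>carrier A. a \<otimes>\<^bsub>A\<^esub> x \<in> ?M"
  proof (intro ballI)
    fix a x assume "a \<in> ?M" "x \<in> carrier A"
    then obtain f g where "f \<in> F 0" "vertex_coeff v f = 0" "a = cls f" "g \<in> F 0" "x = cls g"
      by (auto simp: A_fields(1))
    then show "a \<otimes>\<^bsub>A\<^esub> x \<in> ?M"
      by (simp add: mem F_mult0 vertex_coeff_mult)
  qed
  ultimately show ?thesis
    unfolding maximal_right_ideal_def right_ideal_def[of ?M] by (intro conjI allI impI; (elim conjE)?; simp)
qed

lemma jacobson_radical_A: "jacobson_radical A = cls ` F (Suc 0)"
proof
  show "cls ` F (Suc 0) \<subseteq> jacobson_radical A"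
    using cls_F_subset_maximal cls_in_A F_F0 by (auto simp: jacobson_radical_def)
  show "jacobson_radical A \<subseteq> cls ` F (Suc 0)"
  proof
    fix x assume x: "x \<in> jacobson_radical A"
    then obtain f where f: "f \<in> F 0" "x = cls f"
      by (auto simp: jacobson_radical_def A_fields)
    have "vertex_coeff v f = 0" if v: "v \<in> verts Q" for v
    proof -
      from x maximal_vertex_ideal[OF v] have "x \<in> cls ` {f \<in> F 0. vertex_coeff v f = 0}"
        by (auto simp: jacobson_radical_def)
      then obtain g where "f - g \<in> I" "vertex_coeff v g = 0"
        using f by (auto simp: cls_eq_iff)
      then show ?thesis
        using vertex_coeff_I[OF v, of "f - g"] by (simp add: vertex_coeff_diff)
    qed
    with f show "x \<in> cls ` F (Suc 0)"
      by (simp add: F_Suc_0_iff)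
  qed
qed

section \<open>The associated graded algebra\<close>

abbreviation gr :: "('k, nat \<Rightarrow> (('v, 'e) path \<Rightarrow>\<^sub>0 'k) set set) module" where
  "gr \<equiv> assoc_graded A (jacobson_radical A)"

text \<open>The homogeneous element of degree \<open>n\<close> represented by \<open>f\<close>; it is meant for \<open>f \<in> F n\<close>.\<close>

definition gcls :: "nat \<Rightarrow> (('v, 'e) path \<Rightarrow>\<^sub>0 'k) \<Rightarrow> (('v, 'e) path \<Rightarrow>\<^sub>0 'k) set set" where
  "gcls n f = cls ` F (Suc n) +>\<^bsub>A\<^esub> cls f"

lemma ideal_power_J: "ideal_power A (jacobson_radical A) n = cls ` F n"
  by (simp add: jacobson_radical_A ideal_power_cls_F)

lemma gcls_eq:
  assumes "f \<in> F 0"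
  shows "gcls n f = {cls g | g. g \<in> F 0 \<and> g - f \<in> K (Suc n)}" (is "_ = ?R")
proof
  show "gcls n f \<subseteq> ?R"
  proof
    fix x assume "x \<in> gcls n f"
    then obtain h where h: "h \<in> F (Suc n)" "x = cls h \<oplus>\<^bsub>A\<^esub> cls f"
      by (auto simp: gcls_def a_r_coset_def')
    then have "x = cls (h + f)" "h + f \<in> F 0" "h + f - f \<in> K (Suc n)"
      using assms by (auto simp: F_F0 F_add F_subset_K)
    then show "x \<in> ?R"
      by blast
  qed
  show "?R \<subseteq> gcls n f"
  proof
    fix x assume "x \<in> ?R"
    then obtain g h where g: "x = cls g" "g \<in> F 0" and h: "h \<in> F (Suc n)" "g - f - h \<in> I"
      by (auto simp: K_def)
    have "x = cls (h + f)"
      using g h by (simp add: cls_eq_iff algebra_simps)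
    then have "x = cls h \<oplus>\<^bsub>A\<^esub> cls f"
      using h assms by (simp add: F_F0)
    with h show "x \<in> gcls n f"
      unfolding gcls_def a_r_coset_def' by blast
  qed
qed

lemma gcls_eq_iff:
  assumes "f \<in> F 0" "g \<in> F 0"
  shows "gcls n f = gcls n g \<longleftrightarrow> f - g \<in> K (Suc n)"
proof -
  have "gcls n f = gcls n g \<longleftrightarrow> cls f \<ominus>\<^bsub>A\<^esub> cls g \<in> cls ` F (Suc n)"
    unfolding gcls_def using assms
    by (intro A.quotient_eq_iff_same_a_r_cos[symmetric] ideal_cls_F) (auto intro: cls_in_A)
  then show ?thesis
    using assms by (simp add: cls_in_cls_F F_diff)
qed

lemma gcls_self: "f \<in> F 0 \<Longrightarrow> cls f \<in> gcls n f"
  by (auto simp: gcls_eq)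

lemma gcls_zero: "gcls n 0 = cls ` F (Suc n)"
  unfolding gcls_def by (rule A.a_rcos_zero[OF ideal_cls_F]) auto

lemma gcls_add:
  assumes "f \<in> F 0" "g \<in> F 0"
  shows "gcls n f <+>\<^bsub>A\<^esub> gcls n g = gcls n (f + g)"
  using ideal.a_rcos_sum[OF ideal_cls_F cls_in_A[OF assms(1)] cls_in_A[OF assms(2)]] assms
  by (simp add: gcls_def)

lemma gcls_smult:
  assumes "f \<in> F 0"
  shows "coset_smult A (cls ` F (Suc n)) s (gcls n f) = gcls n (scale s f)"
proof -
  have "cls ` F (Suc n) +>\<^bsub>A\<^esub> (s \<odot>\<^bsub>A\<^esub> x) = gcls n (scale s f)" if x: "x \<in> gcls n f" for x
  proof -
    obtain g where g: "x = cls g" "g \<in> F 0" "g - f \<in> K (Suc n)"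
      using x assms by (auto simp: gcls_eq)
    then show ?thesis
      using assms K_scale[OF g(3), of s]
      by (simp add: A_smult gcls_eq_iff F_scale scale_diff flip: gcls_def)
  qed
  then show ?thesis
    using gcls_self[OF assms, of n] by (auto simp: coset_smult_def)
qed

lemma gcls_mult:
  assumes "f \<in> F i" "g \<in> F j"
  shows "rcoset_mult A (cls ` F (Suc (i + j))) (gcls i f) (gcls j g) = gcls (i + j) (f \<star> g)"
proof -
  have fg: "f \<in> F 0" "g \<in> F 0"
    using assms F_F0 by auto
  have "cls ` F (Suc (i + j)) +>\<^bsub>A\<^esub> (x \<otimes>\<^bsub>A\<^esub> y) = gcls (i + j) (f \<star> g)"
    if x: "x \<in> gcls i f" and y: "y \<in> gcls j g" for x y
  proof -
    obtain f' where f': "x = cls f'" "f' \<in> F 0" "f' - f \<in> K (Suc i)"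
      using x fg by (auto simp: gcls_eq)
    obtain g' where g': "y = cls g'" "g' \<in> F 0" "g' - g \<in> K (Suc j)"
      using y fg by (auto simp: gcls_eq)
    have "f' \<in> K i"
      using K_add[of "f' - f" i f] f'(3) assms K_mono[of i "Suc i"] F_subset_K[of f i] by auto
    then have "f' \<star> g' - f \<star> g \<in> K (Suc (i + j))"
      using f' g' assms by (intro K_mult_add) (auto intro: F_subset_K)
    then show ?thesis
      using f' g' fg by (simp add: gcls_eq_iff F_mult0 flip: gcls_def)
  qed
  then show ?thesis
    using gcls_self[OF fg(1), of i] gcls_self[OF fg(2), of j]
    by (auto simp: rcoset_mult_def)
qed

lemma gcls_carrier: "f \<in> F 0 \<Longrightarrow> gcls n f \<in> carrier (A Quot cls ` F (Suc n))"
  by (auto simp: FactRing_def A_RCOSETS_def' gcls_def intro: cls_in_A)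

lemma gcls_finsum:
  fixes m :: nat
  assumes "\<And>i. i \<le> m \<Longrightarrow> h i \<in> F 0"
  shows "finsum (A Quot cls ` F (Suc n)) (\<lambda>i. gcls n (h i)) {..m} = gcls n (\<Sum>i\<le>m. h i)"
proof -
  interpret J: ideal "cls ` F (Suc n)" A
    by (rule ideal_cls_F)
  interpret B: ring "A Quot cls ` F (Suc n)"
    by (rule J.quotient_is_ring)
  have add: "add (A Quot cls ` F (Suc n)) = set_add A"
    by (simp add: FactRing_def)
  show ?thesis
    using assms
  proof (induction m)
    case 0
    then show ?case
      by (subst B.finsum_0) (auto intro: gcls_carrier)
  next
    case (Suc m)
    have "finsum (A Quot cls ` F (Suc n)) (\<lambda>i. gcls n (h i)) {..Suc m}
        = gcls n (h (Suc m)) <+>\<^bsub>A\<^esub> finsum (A Quot cls ` F (Suc n)) (\<lambda>i. gcls n (h i)) {..m}"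
      using Suc.prems by (subst B.finsum_Suc) (auto intro: gcls_carrier simp: add)
    also have "\<dots> = gcls n (h (Suc m)) <+>\<^bsub>A\<^esub> gcls n (\<Sum>i\<le>m. h i)"
      using Suc by simp
    also have "\<dots> = gcls n (\<Sum>i\<le>Suc m. h i)"
      using Suc.prems by (subst gcls_add) (auto intro!: F_sum simp: add.commute)
    finally show ?case .
  qed
qed

text \<open>
  Every element of the associated graded algebra is \<open>gr_of h\<close> for a sequence of representatives
  \<open>h n \<in> F n\<close>. The operations below are those of the path algebra on such sequences, so that no
  cosets of cosets occur in later arguments.
\<close>

definition gr_of :: "(nat \<Rightarrow> (('v, 'e) path \<Rightarrow>\<^sub>0 'k)) \<Rightarrow> nat \<Rightarrow> (('v, 'e) path \<Rightarrow>\<^sub>0 'k) set set" where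
  "gr_of h = (\<lambda>n. gcls n (h n))"

lemma gr_of_eq_iff:
  assumes "\<And>n. h n \<in> F n" "\<And>n. h' n \<in> F n"
  shows "gr_of h = gr_of h' \<longleftrightarrow> (\<forall>n. h n - h' n \<in> K (Suc n))"
  using F_F0[OF assms(1)] F_F0[OF assms(2)] by (simp add: gr_of_def fun_eq_iff gcls_eq_iff)

lemma gr_carrier:
  "x \<in> carrier gr \<longleftrightarrow> (\<exists>h. (\<forall>n. h n \<in> F n) \<and> finite {n. h n \<notin> K (Suc n)} \<and> x = gr_of h)"
proof -
  have *: "x \<in> carrier gr \<longleftrightarrow>
      (\<forall>n. \<exists>f\<in>F n. x n = gcls n f) \<and> finite {n. x n \<noteq> gcls n 0}"
    unfolding gcls_zero by (simp add: assoc_graded_def ideal_power_J gcls_def del: ideal_power.simps)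
  have fin: "{n. gcls n (h n) \<noteq> gcls n 0} = {n. h n \<notin> K (Suc n)}" if "\<And>n. h n \<in> F n" for h
    using F_F0[OF that] by (simp add: gcls_eq_iff)
  show ?thesis
  proof
    assume "x \<in> carrier gr"
    with * obtain h where h: "\<And>n. h n \<in> F n" "\<And>n. x n = gcls n (h n)" "finite {n. x n \<noteq> gcls n 0}"
      by metis
    moreover have "x = gr_of h"
      using h by (auto simp: gr_of_def)
    ultimately show "\<exists>h. (\<forall>n. h n \<in> F n) \<and> finite {n. h n \<notin> K (Suc n)} \<and> x = gr_of h"
      using fin[of h] by auto
  next
    assume "\<exists>h. (\<forall>n. h n \<in> F n) \<and> finite {n. h n \<notin> K (Suc n)} \<and> x = gr_of h"
    then show "x \<in> carrier gr"
      unfolding * using fin by (auto simp: gr_of_def)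
  qed
qed

lemma gr_add:
  assumes "\<And>n. h n \<in> F n" "\<And>n. h' n \<in> F n"
  shows "gr_of h \<oplus>\<^bsub>gr\<^esub> gr_of h' = gr_of (\<lambda>n. h n + h' n)"
  using F_F0[OF assms(1)] F_F0[OF assms(2)] by (simp add: assoc_graded_def gr_of_def gcls_add)

lemma gr_one: "\<one>\<^bsub>gr\<^esub> = gr_of (\<lambda>n. if n = 0 then path_one else 0)"
proof
  show "\<one>\<^bsub>gr\<^esub> n = gr_of (\<lambda>n. if n = 0 then path_one else 0) n" for n
    using gcls_zero[of n]
    by (simp add: assoc_graded_def gr_of_def ideal_power_J A_fields(4) gcls_def del: ideal_power.simps)
qed

lemma gr_smult:
  assumes "\<And>n. h n \<in> F n"
  shows "s \<odot>\<^bsub>gr\<^esub> gr_of h = gr_of (\<lambda>n. scale s (h n))"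
  using F_F0[OF assms]
  by (simp add: assoc_graded_def gr_of_def gcls_smult ideal_power_J del: ideal_power.simps)

lemma gr_mult:
  assumes "\<And>n. h n \<in> F n" "\<And>n. h' n \<in> F n"
  shows "gr_of h \<otimes>\<^bsub>gr\<^esub> gr_of h' = gr_of (\<lambda>n. \<Sum>i\<le>n. h i \<star> h' (n - i))"
proof
  fix n
  interpret J: ideal "cls ` F (Suc n)" A
    by (rule ideal_cls_F)
  interpret B: ring "A Quot cls ` F (Suc n)"
    by (rule J.quotient_is_ring)
  have F0: "h i \<star> h' (n - i) \<in> F 0" for i
    by (intro F_mult0(1) F_F0[OF assms(1)] F_F0[OF assms(2)])
  have "(gr_of h \<otimes>\<^bsub>gr\<^esub> gr_of h') n = finsum (A Quot cls ` F (Suc n))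
      (\<lambda>i. rcoset_mult A (cls ` F (Suc n)) (gcls i (h i)) (gcls (n - i) (h' (n - i)))) {..n}"
    by (simp add: assoc_graded_def ideal_power_J gr_of_def del: ideal_power.simps)
  also have "\<dots> = finsum (A Quot cls ` F (Suc n)) (\<lambda>i. gcls n (h i \<star> h' (n - i))) {..n}"
  proof (rule B.finsum_cong')
    show "(\<lambda>i. gcls n (h i \<star> h' (n - i))) \<in> {..n} \<rightarrow> carrier (A Quot cls ` F (Suc n))"
      using F0 by (auto intro: gcls_carrier)
    show "rcoset_mult A (cls ` F (Suc n)) (gcls i (h i)) (gcls (n - i) (h' (n - i)))
        = gcls n (h i \<star> h' (n - i))" if "i \<in> {..n}" for i
      using gcls_mult[of "h i" i "h' (n - i)" "n - i"] assms that by simp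
  qed simp
  also have "\<dots> = gr_of (\<lambda>n. \<Sum>i\<le>n. h i \<star> h' (n - i)) n"
    unfolding gr_of_def using F0 by (intro gcls_finsum) auto
  finally show "(gr_of h \<otimes>\<^bsub>gr\<^esub> gr_of h') n = gr_of (\<lambda>n. \<Sum>i\<le>n. h i \<star> h' (n - i)) n" .
qed

section \<open>Homogeneous relations\<close>

text \<open>
  If \<open>I\<close> contains the homogeneous parts of its elements, then taking homogeneous parts makes sense
  in \<open>A\<close>, and the isomorphism sends an element to the sequence of its parts. It is injective because
  an element of degree \<open>n\<close> that lies in the power \<open>n + 1\<close> of the radical is zero, and surjective
  because an element of the power \<open>n\<close> of the radical agrees with its part of degree \<open>n\<close> modulo the
  power \<open>n + 1\<close>.
\<close>

theorem tightly_graded_if_homogeneous: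
  assumes hom: "\<And>f n. f \<in> I \<Longrightarrow> degree_part n f \<in> I"
  shows "tightly_graded A"
proof -
  obtain m where m: "F m \<subseteq> I"
    using ex_F_subset_I by auto
  have K_part: "degree_part i f \<in> I" if "f \<in> K n" "i < n" for f n i
  proof -
    from that obtain g where g: "g \<in> F n" "f - g \<in> I"
      by (auto simp: K_def)
    then have "degree_part i f = degree_part i (f - g) + 0"
      using degree_part_F_eq_0[OF g(1) that(2)] by (simp add: degree_part_diff)
    then show ?thesis
      using hom[OF g(2)] by simp
  qed
  have I_if_parts: "f \<in> I" if "f \<in> F 0" "\<And>n. degree_part n f \<in> I" for f
  proof -
    have "(\<Sum>i<m. degree_part i f) \<in> I"
      using that(2) by (induction m) (auto intro: I_add)
    moreover have "f - (\<Sum>i<m. degree_part i f) \<in> I"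
      using sum_degree_part[OF that(1)] m by auto
    ultimately have "(f - (\<Sum>i<m. degree_part i f)) + (\<Sum>i<m. degree_part i f) \<in> I"
      by (intro I_add)
    then show ?thesis
      by simp
  qed
  define \<phi>0 where "\<phi>0 f = gr_of (\<lambda>n. degree_part n f)" for f
  have part_F: "degree_part n f \<in> F n" if "f \<in> F 0" for f n
    using degree_part_in_F that by auto
  have \<phi>0_eq_iff: "\<phi>0 f = \<phi>0 g \<longleftrightarrow> f - g \<in> I" if "f \<in> F 0" "g \<in> F 0" for f g
  proof -
    have "\<phi>0 f = \<phi>0 g \<longleftrightarrow> (\<forall>n. degree_part n (f - g) \<in> K (Suc n))"
      using that by (simp add: \<phi>0_def gr_of_eq_iff part_F degree_part_diff)
    also have "\<dots> \<longleftrightarrow> f - g \<in> I"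
    proof safe
      assume *: "\<forall>n. degree_part n (f - g) \<in> K (Suc n)"
      have "degree_part n (f - g) \<in> I" for n
        using K_part[of "degree_part n (f - g)" "Suc n" n] * by (simp add: degree_part_degree_part)
      then show "f - g \<in> I"
        using that by (simp add: I_if_parts F_diff)
    qed (auto intro: I_subset_K hom)
    finally show ?thesis .
  qed
  define \<phi> where "\<phi> X = \<phi>0 (SOME f. f \<in> F 0 \<and> X = cls f)" for X
  have \<phi>: "\<phi> (cls f) = \<phi>0 f" if "f \<in> F 0" for f
  proof -
    let ?g = "SOME g. g \<in> F 0 \<and> cls f = cls g"
    have "?g \<in> F 0 \<and> cls f = cls ?g"
      by (rule someI[of _ f]) (use that in simp)
    then have "\<phi>0 f = \<phi>0 ?g"
      using \<phi>0_eq_iff[OF that, of ?g] by (simp add: cls_eq_iff)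
    then show ?thesis
      by (simp add: \<phi>_def)
  qed
  have carr: "\<phi>0 f \<in> carrier gr" if f: "f \<in> F 0" for f
  proof -
    have "n < m" if "degree_part n f \<notin> K (Suc n)" for n
    proof (rule ccontr)
      assume "\<not> n < m"
      then have "degree_part n f \<in> I"
        using m part_F[OF f, of n] F_mono[of m n] by auto
      with that show False
        by (simp add: I_subset_K)
    qed
    then have "{n. degree_part n f \<notin> K (Suc n)} \<subseteq> {..<m}"
      by auto
    then have "finite {n. degree_part n f \<notin> K (Suc n)}"
      by (rule finite_subset) simp
    then show ?thesis
      unfolding gr_carrier \<phi>0_def using part_F[OF f]
      by (intro exI[of _ "\<lambda>n. degree_part n f"]) simp
  qed
  have surj: "\<exists>f\<in>F 0. x = \<phi>0 f" if "x \<in> carrier gr" for x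
  proof -
    obtain h where "\<forall>n. h n \<in> F n" and x: "x = gr_of h"
      using \<open>x \<in> carrier gr\<close> unfolding gr_carrier by (elim exE conjE)
    then have h: "h n \<in> F n" for n
      by simp
    define f where "f = (\<Sum>n<m. degree_part n (h n))"
    have f: "f \<in> F 0"
      unfolding f_def by (intro F_sum F_F0[OF degree_part_in_F(1)[OF h]])
    have "h n - degree_part n f \<in> K (Suc n)" for n
    proof (cases "n < m")
      case True
      then have "degree_part n f = degree_part n (h n)"
        by (simp add: f_def degree_part_sum degree_part_degree_part sum.delta)
      then show ?thesis
        using diff_degree_part_in_F[OF h[of n]] by (simp add: F_subset_K)
    next
      case False
      then have "degree_part n f = 0"
        by (auto simp: f_def degree_part_sum degree_part_degree_part)
      moreover have "h n \<in> I"
        using m h[of n] F_mono[of m n] False by auto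
      ultimately show ?thesis
        by (simp add: I_subset_K)
    qed
    then have "x = \<phi>0 f"
      using h part_F[OF f] by (simp add: x \<phi>0_def gr_of_eq_iff)
    with f show ?thesis
      by blast
  qed
  have "\<phi> \<in> ring_iso A gr"
  proof (rule ring_iso_memI)
    show "\<phi> x \<in> carrier gr" if "x \<in> carrier A" for x
      using that unfolding A_fields(1) by (elim imageE) (simp add: \<phi> carr)
    show "\<phi> (x \<otimes>\<^bsub>A\<^esub> y) = \<phi> x \<otimes>\<^bsub>gr\<^esub> \<phi> y" if "x \<in> carrier A" "y \<in> carrier A" for x y
      using that unfolding A_fields(1)
      by (elim imageE) (simp add: \<phi> F_mult0 \<phi>0_def gr_mult part_F degree_part_mult)
    show "\<phi> (x \<oplus>\<^bsub>A\<^esub> y) = \<phi> x \<oplus>\<^bsub>gr\<^esub> \<phi> y" if "x \<in> carrier A" "y \<in> carrier A" for x y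
      using that unfolding A_fields(1)
      by (elim imageE) (simp add: \<phi> F_add \<phi>0_def gr_add part_F degree_part_add)
    have "degree_part n path_one = (if n = 0 then path_one else 0)" for n
      by (simp add: path_one_def degree_part_sum degree_part_term)
    then show "\<phi> \<one>\<^bsub>A\<^esub> = \<one>\<^bsub>gr\<^esub>"
      by (simp add: A_fields(4) \<phi> path_one_in_F \<phi>0_def gr_one)
    show "bij_betw \<phi> (carrier A) (carrier gr)"
    proof (rule bij_betwI')
      show "\<phi> x = \<phi> y \<longleftrightarrow> x = y" if "x \<in> carrier A" "y \<in> carrier A" for x y
        using that unfolding A_fields(1) by (elim imageE) (simp add: \<phi> \<phi>0_eq_iff cls_eq_iff)
      show "\<phi> x \<in> carrier gr" if "x \<in> carrier A" for x
        using that unfolding A_fields(1) by (elim imageE) (simp add: \<phi> carr)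
      show "\<exists>x\<in>carrier A. y = \<phi> x" if "y \<in> carrier gr" for y
      proof -
        from surj[OF that] obtain f where "f \<in> F 0" "y = \<phi>0 f"
          by blast
        then show ?thesis
          by (intro bexI[of _ "cls f"]) (simp_all add: \<phi> cls_in_A)
      qed
    qed
  qed
  moreover have "\<phi> (s \<odot>\<^bsub>A\<^esub> x) = s \<odot>\<^bsub>gr\<^esub> \<phi> x" if "x \<in> carrier A" for s x
    using that unfolding A_fields(1)
    by (elim imageE) (simp add: A_smult \<phi> F_scale \<phi>0_def gr_smult part_F degree_part_scale)
  ultimately have "\<phi> \<in> algebra_iso A gr"
    by (simp add: algebra_iso_def)
  then show ?thesis
    unfolding tightly_graded_def by blast
qed

section \<open>An obstruction to tight gradedness\<close>

text \<open>
  By \<open>y_mult\<close>, the homogeneous element of degree \<open>d\<close> represented by \<open>y\<close> is killed by all elements of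
  the associated graded algebra without component in degree 0. An isomorphism from \<open>A\<close> maps the
  radical to such elements: elements of the radical are nilpotent, and the subalgebra of degree 0,
  a product of fields, has no nilpotent elements except 0. Hence the preimage of \<open>y\<close> is killed
  by the radical and lies in the power \<open>d + 1\<close> of the radical by \<open>socle\<close>. The isomorphism maps that power
  to elements without components of degree at most \<open>d\<close>, so \<open>y\<close> represents 0 in degree \<open>d\<close>.
\<close>

theorem tightly_graded_socle:
  assumes tight: "tightly_graded A" and y: "y \<in> F d"
    and y_mult: "\<And>q. q \<in> F (Suc 0) \<Longrightarrow> y \<star> q \<in> K (Suc (Suc d))"
    and socle: "\<And>f. f \<in> F 0 \<Longrightarrow> (\<And>q. q \<in> F (Suc 0) \<Longrightarrow> f \<star> q \<in> I) \<Longrightarrow> f \<in> K (Suc d)"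
  shows "y \<in> K (Suc d)"
proof -
  obtain \<phi> where "\<phi> \<in> algebra_iso A gr"
    using tight by (auto simp: tightly_graded_def)
  then have iso: "\<phi> \<in> ring_hom A gr" "bij_betw \<phi> (carrier A) (carrier gr)"
    by (auto simp: algebra_iso_def ring_iso_def)
  have "\<exists>h. (\<forall>n. h n \<in> F n) \<and> \<phi> (cls f) = gr_of h" if "f \<in> F 0" for f
  proof -
    have "\<phi> (cls f) \<in> carrier gr"
      using ring_hom_closed[OF iso(1) cls_in_A[OF that]] .
    then show ?thesis
      unfolding gr_carrier by blast
  qed
  \<comment> \<open>\<open>H f\<close> is a sequence of representatives of the image of \<open>f\<close>; it is additive and multiplicative
     only up to \<open>K (Suc n)\<close> in degree \<open>n\<close>.\<close>
  then obtain H where "\<forall>f\<in>F 0. (\<forall>n. H f n \<in> F n) \<and> \<phi> (cls f) = gr_of (H f)"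
    by metis
  then have H: "\<And>n. H f n \<in> F n" and \<phi>_H: "\<phi> (cls f) = gr_of (H f)" if "f \<in> F 0" for f
    using that by auto
  have H_add: "H (f + g) n - (H f n + H g n) \<in> K (Suc n)" if fg: "f \<in> F 0" "g \<in> F 0" for f g n
  proof -
    have "gr_of (H (f + g)) = gr_of (\<lambda>n. H f n + H g n)"
      using ring_hom_add[OF iso(1) cls_in_A[OF fg(1)] cls_in_A[OF fg(2)]] fg
      by (simp add: \<phi>_H F_add gr_add H)
    then show ?thesis
      using fg by (subst (asm) gr_of_eq_iff) (auto intro: H F_add)
  qed
  have H_mult: "H (f \<star> g) n - (\<Sum>i\<le>n. H f i \<star> H g (n - i)) \<in> K (Suc n)"
    if fg: "f \<in> F 0" "g \<in> F 0" for f g n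
  proof -
    have eq: "gr_of (H (f \<star> g)) = gr_of (\<lambda>n. \<Sum>i\<le>n. H f i \<star> H g (n - i))"
      using ring_hom_mult[OF iso(1) cls_in_A[OF fg(1)] cls_in_A[OF fg(2)]] fg
      by (simp add: \<phi>_H F_mult0 gr_mult H)
    have "(\<Sum>i\<le>n. H f i \<star> H g (n - i)) \<in> F n" for n
    proof (intro F_sum)
      fix i assume "i \<in> {..n}"
      then show "H f i \<star> H g (n - i) \<in> F n"
        using F_mult[OF H[OF fg(1), of i] H[OF fg(2), of "n - i"]] by simp
    qed
    with eq show ?thesis
      using fg by (simp add: gr_of_eq_iff H F_mult0)
  qed
  have H_cong: "H f n - H g n \<in> K (Suc n)" if "f \<in> F 0" "g \<in> F 0" "f - g \<in> I" for f g n
  proof -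
    have "cls f = cls g"
      using that by (simp add: cls_eq_iff)
    then have "gr_of (H f) = gr_of (H g)"
      using that \<phi>_H by metis
    then show ?thesis
      using that by (simp add: gr_of_eq_iff H)
  qed
  have H_zero: "H 0 n \<in> K (Suc n)" for n
    using K_uminus[OF H_add[of 0 0 n]] by simp
  have H_I: "H f n \<in> K (Suc n)" if "f \<in> I" for f n
    using K_add[OF H_cong[of f 0 n] H_zero[of n]] that by (simp add: I_F0)
  \<comment> \<open>A high power of \<open>f\<close> is 0 in \<open>A\<close>, so each vertex coefficient of \<open>H f 0\<close> is a nilpotent scalar.\<close>
  have H_rad: "H f 0 \<in> K (Suc 0)" if f: "f \<in> F (Suc 0)" for f
  proof -
    have "vertex_coeff v (H f 0) = 0" if v: "v \<in> verts Q" for v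
    proof -
      have vz: "vertex_coeff v g = 0" if "g \<in> K (Suc 0)" for g
        using that v unfolding K_Suc_0 F_Suc_0_iff by blast
      have pow: "\<exists>g\<in>F (Suc n). vertex_coeff v (H g 0) = vertex_coeff v (H f 0) ^ Suc n" for n
      proof (induction n)
        case 0
        show ?case
          using f by auto
      next
        case (Suc n)
        then obtain g where g: "g \<in> F (Suc n)" "vertex_coeff v (H g 0) = vertex_coeff v (H f 0) ^ Suc n"
          by auto
        have fg0: "g \<in> F 0" "f \<in> F 0"
          using g f F_F0 by auto
        have "vertex_coeff v (H (g \<star> f) 0 - H g 0 \<star> H f 0) = 0"
          using H_mult[OF fg0, of 0] by (intro vz) simp
        then have "vertex_coeff v (H (g \<star> f) 0) = vertex_coeff v (H f 0) ^ Suc (Suc n)"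
          using g H[OF fg0(1), of 0] H[OF fg0(2), of 0]
          by (simp add: vertex_coeff_diff vertex_coeff_mult)
        moreover have "g \<star> f \<in> F (Suc (Suc n))"
          using F_mult[OF g(1) f] by simp
        ultimately show ?case
          by blast
      qed
      obtain m where m: "F m \<subseteq> I"
        using ex_F_subset_I by auto
      from pow[of m] obtain g where g: "g \<in> F (Suc m)"
        "vertex_coeff v (H g 0) = vertex_coeff v (H f 0) ^ Suc m"
        by auto
      then have "g \<in> I"
        using m F_mono[of m "Suc m"] by auto
      then have "vertex_coeff v (H g 0) = 0"
        by (intro vz H_I)
      with g have "vertex_coeff v (H f 0) ^ Suc m = 0"
        by metis
      then show ?thesis
        unfolding power_eq_0_iff by blast
    qed
    then show ?thesis
      using H[OF F_F0[OF f], of 0] by (simp add: K_Suc_0 F_Suc_0_iff)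
  qed
  have H_filtered: "H f i \<in> K (Suc i)" if "f \<in> F n" "i < n" for f n i
    using that
  proof (induction n arbitrary: f i)
    case (Suc n)
    have "f \<in> F (n + Suc 0)"
      using Suc.prems by simp
    then show ?case
    proof (induction rule: F_mult_induct)
      case zero
      show ?case
        by (rule H_zero)
    next
      case (mult f g)
      have fg: "f \<in> F 0" "g \<in> F 0"
        using mult F_F0 by auto
      have "H f j \<star> H g (i - j) \<in> K (Suc i)" if j: "j \<in> {..i}" for j
      proof (cases "j < n")
        case True
        then show ?thesis
          using K_mult[OF Suc.IH[OF mult(1) True] F_subset_K[OF H[OF fg(2), of "i - j"]]] j
          by simp
      next
        case False
        \<comment> \<open>Only one product is not covered by induction; its second factor has degree 0 and comes from
           the radical.\<close>
        with j Suc.prems have "j = n" "i = n"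
          by auto
        then show ?thesis
          using K_mult[OF F_subset_K[OF H[OF fg(1), of n]] H_rad[OF mult(2)]] by simp
      qed
      then have "(\<Sum>j\<le>i. H f j \<star> H g (i - j)) \<in> K (Suc i)"
        by (intro K_sum) auto
      from K_add[OF H_mult[OF fg, of i] this] show ?case
        by simp
    next
      case (add f g)
      have fg: "f \<in> F 0" "g \<in> F 0"
        using add F_F0 by auto
      from K_add[OF H_add[OF fg, of i] K_add[OF add(3,4)]] show ?case
        by simp
    qed
  qed simp
  define hy where "hy n = (if n = d then y else 0)" for n
  have hy: "hy n \<in> F n" for n
    using y by (simp add: hy_def)
  have "gr_of hy \<in> carrier gr"
    unfolding gr_carrier using hy
    by (intro exI[of _ hy] conjI allI refl) (auto intro!: finite_subset[of _ "{d}"] simp: hy_def)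
  then obtain X where "X \<in> carrier A" "\<phi> X = gr_of hy"
    using bij_betw_imp_surj_on[OF iso(2)] by (metis imageE)
  then obtain f where f: "f \<in> F 0" and \<phi>f: "\<phi> (cls f) = gr_of hy"
    by (auto simp: A_fields(1))
  have y_K: "y \<star> z \<in> K (Suc d + k)" if z: "z \<in> F k" "0 < k" for z k
  proof -
    obtain k' where k: "k = Suc 0 + k'"
      using z(2) by (cases k) auto
    with z(1) have "z \<in> F (Suc 0 + k')"
      by simp
    then have "y \<star> z \<in> K (Suc (Suc d) + k')"
    proof (induction rule: F_mult_induct)
      case (mult a b)
      have "y \<star> (a \<star> b) = (y \<star> a) \<star> b"
        by (simp add: path_mult_assoc)
      then show ?case
        using K_mult[OF y_mult[OF mult(1)] F_subset_K[OF mult(2)]] by simp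
    qed (auto simp: path_mult_add_right intro: K_add)
    then show ?thesis
      using k by simp
  qed
  have "f \<star> q \<in> I" if q: "q \<in> F (Suc 0)" for q
  proof -
    have q0: "q \<in> F 0"
      using q by (rule F_F0)
    have sum_F: "(\<Sum>i\<le>n. hy i \<star> H q (n - i)) \<in> F n" for n
    proof (intro F_sum)
      fix i assume "i \<in> {..n}"
      then show "hy i \<star> H q (n - i) \<in> F n"
        using F_mult[OF hy[of i] H[OF q0, of "n - i"]] by simp
    qed
    have sum_K: "(\<Sum>i\<le>n. hy i \<star> H q (n - i)) \<in> K (Suc n)" for n
    proof (intro K_sum)
      fix i assume i: "i \<in> {..n}"
      show "hy i \<star> H q (n - i) \<in> K (Suc n)"
      proof (cases "i = d")
        case True
        show ?thesis
        proof (cases "n = d")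
          case True
          then show ?thesis
            using K_mult[OF F_subset_K[OF y] H_rad[OF q]] \<open>i = d\<close> by (simp add: hy_def)
        next
          case False
          then show ?thesis
            using y_K[OF H[OF q0, of "n - d"]] \<open>i = d\<close> i by (simp add: hy_def)
        qed
      qed (simp add: hy_def)
    qed
    have "\<phi> (cls (f \<star> q)) = gr_of (\<lambda>n. \<Sum>i\<le>n. hy i \<star> H q (n - i))"
      using ring_hom_mult[OF iso(1) cls_in_A[OF f] cls_in_A[OF q0]] f q0
      by (simp add: \<phi>f \<phi>_H gr_mult hy H)
    also have "\<dots> = gr_of (H 0)"
      using sum_F sum_K H_zero by (subst gr_of_eq_iff) (auto intro: H K_diff)
    also have "\<dots> = \<phi> (cls 0)"
      by (simp add: \<phi>_H)
    finally have "cls (f \<star> q) = cls 0"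
      using inj_onD[OF bij_betw_imp_inj_on[OF iso(2)]] f q0
      by (simp add: cls_in_A F_mult0)
    then show ?thesis
      by (simp add: cls_eq_iff)
  qed
  then have "f \<in> K (Suc d)"
    by (rule socle[OF f])
  then obtain g where g: "g \<in> F (Suc d)" "f - g \<in> I"
    by (auto simp: K_def)
  then have "cls f = cls g"
    by (simp add: cls_eq_iff)
  with \<phi>f have "gr_of (H g) = gr_of hy"
    using \<phi>_H[OF F_F0[OF g(1)]] by simp
  then have "H g d - hy d \<in> K (Suc d)"
    using g hy by (subst (asm) gr_of_eq_iff) (auto intro: H F_F0)
  from K_diff[OF H_filtered[OF g(1), of d] this] show ?thesis
    by (simp add: hy_def)
qed

end

section \<open>Words and relations\<close>

text \<open>
  In the quivers below, each arrow \<open>a\<close> has a single successor \<open>f a\<close> with which its product is not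
  one of the monomial relations. So the only words that can be nonzero are the following ones.
\<close>

primrec orbit_word :: "('e \<Rightarrow> 'e) \<Rightarrow> 'e \<Rightarrow> nat \<Rightarrow> 'e list" where
  "orbit_word f a 0 = []"
| "orbit_word f a (Suc n) = a # orbit_word f (f a) n"

lemma length_orbit_word [simp]: "length (orbit_word f a n) = n"
  by (induction n arbitrary: a) auto

lemma orbit_word_add: "orbit_word f a (m + n) = orbit_word f a m @ orbit_word f ((f ^^ m) a) n"
  by (induction m arbitrary: a) (auto simp: funpow_swap1)

lemma orbit_word_successor: "orbit_word f a n = u @ x # y # v \<Longrightarrow> y = f x"
proof (induction n arbitrary: a u)
  case (Suc n)
  then show ?case
  proof (cases u)
    case Nil
    with Suc.prems show ?thesis
      by (cases n) auto
  qed auto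
qed auto

lemma hd_orbit_word [simp]: "0 < n \<Longrightarrow> hd (orbit_word f a n) = a"
  by (cases n) auto

lemma orbit_word_eq_Nil_iff [simp]: "orbit_word f a n = [] \<longleftrightarrow> n = 0"
  by (cases n) auto

context finite_quiver
begin

abbreviation wp :: "'e list \<Rightarrow> ('v, 'e) path \<Rightarrow>\<^sub>0 'k" where "wp \<equiv> path_of Q"

definition walk :: "'e list \<Rightarrow> bool" where
  "walk w \<longleftrightarrow> w \<noteq> [] \<and> set w \<subseteq> arcs Q \<and> successively (\<lambda>a b. head Q a = tail Q b) w"

lemma walk_Cons: "walk (a # w) \<longleftrightarrow> a \<in> arcs Q \<and> (w = [] \<or> head Q a = tail Q (hd w) \<and> walk w)"
  by (cases w) (auto simp: walk_def)

lemma walk_append: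
  "u \<noteq> [] \<Longrightarrow> v \<noteq> [] \<Longrightarrow> walk (u @ v) \<longleftrightarrow> walk u \<and> walk v \<and> head Q (last u) = tail Q (hd v)"
  by (auto simp: walk_def successively_append_iff)

lemma paths_iff_walk:
  assumes "w \<noteq> []"
  shows "(u, w, v) \<in> paths Q \<longleftrightarrow> walk w \<and> u = tail Q (hd w) \<and> v = head Q (last w)"
  using assms
proof (induction w arbitrary: u)
  case (Cons a w)
  have "(u, a # w, v) \<in> paths Q \<longleftrightarrow> a \<in> arcs Q \<and> u = tail Q a \<and> (head Q a, w, v) \<in> paths Q"
    by (auto simp: paths_def awalk_def)
  moreover have "(head Q a, [], v) \<in> paths Q \<longleftrightarrow> v = head Q a" if "a \<in> arcs Q"
    using that by (auto simp: paths_def awalk_Nil_iff)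
  ultimately show ?case
    using Cons by (cases "w = []") (auto simp: walk_Cons)
qed simp

lemma path_eq_wp:
  assumes "(u, w, v) \<in> paths Q" "w \<noteq> []"
  shows "term_of (u, w, v) c = scale c (wp w)"
  using assms by (simp add: paths_iff_walk path_of_def)

lemma wp_in_F: "walk w \<Longrightarrow> n \<le> length w \<Longrightarrow> wp w \<in> F n"
  unfolding path_of_def using paths_iff_walk[of w] by (intro F_term) (auto simp: walk_def)

lemma degree_part_wp: "degree_part n (wp w) = (if length w = n then wp w else 0)"
  by (simp add: path_of_def degree_part_term)

lemma wp_append:
  assumes "u \<noteq> []" "v \<noteq> []" "head Q (last u) = tail Q (hd v)"
  shows "wp (u @ v) = wp u \<star> wp v"
  using assms by (simp add: path_of_def term_mult_term)

end

locale quiver_relations = finite_quiver Q P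
  for Q :: "('v, 'e) pre_digraph" and P :: "('k::field, ('v, 'e) path \<Rightarrow>\<^sub>0 'k) module" +
  fixes S I :: "(('v, 'e) path \<Rightarrow>\<^sub>0 'k) set"
  assumes S_subset: "S \<subseteq> F (Suc 0)"
    and I_def: "I = Idl\<^bsub>P\<^esub> S"
begin

lemma S_F0: "S \<subseteq> F 0"
  using S_subset F_mono[of 0 "Suc 0"] by auto

sublocale path_algebra_ideal Q P I
proof (intro path_algebra_ideal.intro path_algebra_ideal_axioms.intro finite_quiver_axioms)
  show "ideal I P"
    unfolding I_def by (rule genideal_ideal) (use S_F0 in simp)
qed

lemma S_subset_I: "S \<subseteq> I"
  unfolding I_def by (rule genideal_self) (use S_F0 in simp)

lemma I_subset_if_ideal: "ideal M P \<Longrightarrow> S \<subseteq> M \<Longrightarrow> I \<subseteq> M"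
  unfolding I_def by (rule genideal_minimal)

lemma I_subset: "I \<subseteq> F (Suc 0)"
  by (rule I_subset_if_ideal[OF ideal_F S_subset])

text \<open>
  The elements of the path algebra whose homogeneous parts all lie in \<open>I\<close> form an ideal, so it is
  enough to look at generators.
\<close>

lemma degree_part_in_I:
  assumes S: "\<And>s n. s \<in> S \<Longrightarrow> degree_part n s \<in> I" and f: "f \<in> I"
  shows "degree_part n f \<in> I"
proof -
  let ?M = "{f \<in> F 0. \<forall>n. degree_part n f \<in> I}"
  have sumI: "(\<Sum>i\<le>n. h i) \<in> I" if "\<And>i. h i \<in> I" for h :: "nat \<Rightarrow> ('v, 'e) path \<Rightarrow>\<^sub>0 'k" and n
    by (induction n) (use that in \<open>auto intro: I_add\<close>)
  have "ideal ?M P"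
  proof (rule P_idealI)
    fix f g assume "f \<in> ?M" "g \<in> F 0"
    then have fg': "f \<in> F 0" "\<And>n. degree_part n f \<in> I" "\<And>n. degree_part n g \<in> F 0"
      by (auto intro: degree_part_in_F)
    have "degree_part n (f \<star> g) \<in> I" for n
      unfolding degree_part_mult by (intro sumI I_mult(1) fg')
    moreover have "degree_part n (g \<star> f) \<in> I" for n
      unfolding degree_part_mult by (intro sumI I_mult(2) fg')
    ultimately show "f \<star> g \<in> ?M" "g \<star> f \<in> ?M"
      using fg' \<open>g \<in> F 0\<close> by (auto simp: F_mult0)
  qed (auto simp: I_zero degree_part_diff intro: F_diff I_diff)
  moreover have "S \<subseteq> ?M"
    using S S_F0 by auto
  ultimately have "I \<subseteq> ?M"
    by (rule I_subset_if_ideal)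
  with f show ?thesis
    by auto
qed

text \<open>
  Linear forms on the path algebra. They serve to show that elements do not belong to \<open>I\<close>.
\<close>

definition coeff_sum :: "('v, 'e) path set \<Rightarrow> (('v, 'e) path \<Rightarrow>\<^sub>0 'k) \<Rightarrow> 'k" where
  "coeff_sum W f = (\<Sum>t\<in>W. coeff_at f t)"

lemma coeff_sum_add: "coeff_sum W (f + g) = coeff_sum W f + coeff_sum W g"
  by (simp add: coeff_sum_def lookup_add sum.distrib)

lemma coeff_sum_diff: "coeff_sum W (f - g) = coeff_sum W f - coeff_sum W g"
  by (simp add: coeff_sum_def lookup_minus sum_subtractf)

lemma coeff_sum_zero [simp]: "coeff_sum W 0 = 0"
  by (simp add: coeff_sum_def)

lemma coeff_sum_term: "finite W \<Longrightarrow> coeff_sum W (term_of t c) = (if t \<in> W then c else 0)"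
  by (simp add: coeff_sum_def lookup_single when_def sum.delta')

lemma coeff_sum_scale: "coeff_sum W (scale s f) = s * coeff_sum W f"
  by (simp add: coeff_sum_def sum_distrib_left)

text \<open>
  The elements \<open>f\<close> such that the linear form vanishes at all \<open>g f h\<close> form the largest ideal in the
  kernel of the linear form. By linearity, membership of a generator can be tested with paths
  \<open>g\<close> and \<open>h\<close>.
\<close>

lemma coeff_sum_I:
  assumes S: "\<And>s p q. s \<in> S \<Longrightarrow> p \<in> paths Q \<Longrightarrow> q \<in> paths Q \<Longrightarrow>
      coeff_sum W (term_of p 1 \<star> s \<star> term_of q 1) = 0"
    and f: "f \<in> I"
  shows "coeff_sum W f = 0"
proof -
  let ?M = "{f \<in> F 0. \<forall>g\<in>F 0. \<forall>h\<in>F 0. coeff_sum W (g \<star> f \<star> h) = 0}"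
  have "ideal ?M P"
  proof (rule P_idealI)
    fix f g assume fg: "f \<in> ?M" "g \<in> F 0"
    have "coeff_sum W (x \<star> (f \<star> g) \<star> y) = 0 \<and> coeff_sum W (x \<star> (g \<star> f) \<star> y) = 0"
      if "x \<in> F 0" "y \<in> F 0" for x y
    proof -
      have "x \<star> (f \<star> g) \<star> y = x \<star> f \<star> (g \<star> y)" "x \<star> (g \<star> f) \<star> y = (x \<star> g) \<star> f \<star> y"
        by (simp_all add: path_mult_assoc)
      with fg that show ?thesis
        by (simp add: F_mult0)
    qed
    then show "f \<star> g \<in> ?M" "g \<star> f \<in> ?M"
      using fg by (auto simp: F_mult0)
  qed (auto simp: path_mult_diff_left path_mult_diff_right coeff_sum_diff F_diff)
  moreover have "S \<subseteq> ?M"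
  proof (intro subsetI CollectI conjI ballI)
    fix s g h assume s: "s \<in> S" and "g \<in> F 0" and h: "h \<in> F 0"
    from \<open>g \<in> F 0\<close> show "coeff_sum W (g \<star> s \<star> h) = 0"
    proof (induction g rule: F_induct)
      case (single p a)
      note p = this
      from h show ?case
      proof (induction h rule: F_induct)
        case (single q b)
        have "term_of p a = scale a (term_of p 1)" "term_of q b = scale b (term_of q 1)"
          by simp_all
        then have "coeff_sum W (term_of p a \<star> s \<star> term_of q b)
            = b * (a * coeff_sum W (term_of p 1 \<star> s \<star> term_of q 1))"
          by (simp only: scale_path_mult coeff_sum_scale)
        with S[OF s] p single show ?case
          by simp
      qed (auto simp: path_mult_add_right coeff_sum_add)
    qed (auto simp: path_mult_add_left coeff_sum_add)
  qed (use S_F0 in auto)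
  ultimately have "I \<subseteq> ?M"
    by (rule I_subset_if_ideal)
  with f have "coeff_sum W (path_one \<star> f \<star> path_one) = 0"
    using path_one_in_F by blast
  then show ?thesis
    using f by (simp add: path_one_mult I_F0)
qed

lemma wp_context:
  assumes "wp w - wp w' \<in> I" "w \<noteq> []" "w' \<noteq> []"
    and "walk (u @ w @ v)" "walk (u @ w' @ v)"
  shows "wp (u @ w @ v) - wp (u @ w' @ v) \<in> I"
proof -
  have right: "wp (w @ v) - wp (w' @ v) \<in> I"
  proof (cases "v = []")
    case False
    have "walk (w @ v)" "walk (w' @ v)"
      using assms by (cases "u = []"; simp add: walk_append)+
    then have "wp (w @ v) - wp (w' @ v) = (wp w - wp w') \<star> wp v" "walk v"
      using assms False by (auto simp: walk_append wp_append path_mult_diff_left)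
    then show ?thesis
      using assms by (auto intro: I_mult wp_in_F)
  qed (use assms in simp)
  show ?thesis
  proof (cases "u = []")
    case False
    have "walk u" "wp (u @ w @ v) - wp (u @ w' @ v) = wp u \<star> (wp (w @ v) - wp (w' @ v))"
      using assms False by (auto simp: walk_append wp_append path_mult_diff_right)
    then show ?thesis
      using right by (auto intro: I_mult wp_in_F)
  qed (use right in simp)
qed

lemma zero_if_related: "wp w - wp w' \<in> I \<Longrightarrow> wp w' \<in> I \<Longrightarrow> wp w \<in> I"
  using I_add[of "wp w - wp w'" "wp w'"] by simp

lemma wp_zero_context:
  assumes "wp w \<in> I" "w \<noteq> []" "walk (u @ w @ v)"
  shows "wp (u @ w @ v) \<in> I"
proof -
  have right: "wp (w @ v) \<in> I"
  proof (cases "v = []")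
    case False
    have "walk (w @ v)"
      using assms by (cases "u = []") (simp_all add: walk_append)
    then show ?thesis
      using assms False by (auto simp: walk_append wp_append intro!: I_mult(1) wp_in_F)
  qed (use assms in simp)
  show ?thesis
    using assms right
    by (cases "u = []") (auto simp: walk_append wp_append intro!: I_mult(2) wp_in_F)
qed

lemma walk_zero_or_orbit:
  assumes nxt: "\<And>a b. a \<in> arcs Q \<Longrightarrow> b \<in> arcs Q \<Longrightarrow> head Q a = tail Q b \<Longrightarrow>
      b = nxt a \<or> wp [a, b] \<in> I"
    and "walk w"
  shows "wp w \<in> I \<or> w = orbit_word nxt (hd w) (length w)"
  using assms(2)
proof (induction w)
  case (Cons a w)
  show ?case
  proof (cases w)
    case (Cons b v)
    with Cons.prems have ab: "a \<in> arcs Q" "b \<in> arcs Q" "head Q a = tail Q b" "walk w"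
      by (auto simp: walk_Cons)
    consider "wp [a, b] \<in> I" | "wp w \<in> I" | "b = nxt a" "w = orbit_word nxt (hd w) (length w)"
      using nxt[OF ab(1-3)] Cons.IH[OF ab(4)] by blast
    then show ?thesis
    proof cases
      case 1
      then show ?thesis
        using wp_zero_context[of "[a, b]" "[]" v] Cons Cons.prems by simp
    next
      case 2
      then show ?thesis
        using wp_zero_context[of w "[a]" "[]"] Cons Cons.prems by simp
    next
      case 3
      then show ?thesis
        using Cons by auto
    qed
  qed simp
qed (simp add: walk_def)

lemma F_subset_I:
  assumes "0 < m" "\<And>w. walk w \<Longrightarrow> m \<le> length w \<Longrightarrow> wp w \<in> I"
  shows "F m \<subseteq> I"
proof
  fix f assume "f \<in> F m"
  then show "f \<in> I"
  proof (induction f rule: F_induct)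
    case (single t c)
    obtain u w v where t: "t = (u, w, v)"
      by (cases t)
    with single assms(1) have "w \<noteq> []"
      by auto
    with single t have "walk w" "term_of t c = scale c (wp w)"
      by (auto simp: paths_iff_walk path_eq_wp)
    with assms(2)[of w] single t show ?case
      by (auto intro: I_scale)
  qed (auto intro: I_zero I_add)
qed

end

section \<open>The algebras \<open>C\<^sub>r\<close> with \<open>r \<ge> 2\<close>\<close>

text \<open>
  The successors that avoid the relations \<open>a\<^sub>1 b\<^sub>1\<close>, \<open>b\<^sub>2 a\<^sub>2\<close>, \<open>a\<^sub>2 c\<close> and \<open>c b\<^sub>2\<close>: one cycle of length 4, and
  the loop.
\<close>

fun nxt :: "arrow \<Rightarrow> arrow" where
  "nxt A1 = A2" | "nxt A2 = B2" | "nxt B2 = B1" | "nxt B1 = A1" | "nxt C = C"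

abbreviation orbit :: "arrow \<Rightarrow> nat \<Rightarrow> arrow list" where "orbit \<equiv> orbit_word nxt"

lemma arcs_C: "arcs quiver_C = UNIV"
  unfolding quiver_C_def by (auto intro: arrow.exhaust)

lemma verts_C: "verts quiver_C = {1, 2, 3}"
  by (simp add: quiver_C_def)

lemma tail_C [simp]:
  "tail quiver_C A1 = 1" "tail quiver_C B1 = 2" "tail quiver_C A2 = 2" "tail quiver_C B2 = 3"
  "tail quiver_C C = 3"
  by (simp_all add: quiver_C_def)

lemma head_C [simp]:
  "head quiver_C A1 = 2" "head quiver_C B1 = 1" "head quiver_C A2 = 3" "head quiver_C B2 = 2"
  "head quiver_C C = 3"
  by (simp_all add: quiver_C_def)

lemma head_eq_tail_nxt: "head quiver_C a = tail quiver_C (nxt a)"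
  by (cases a) auto

lemma wf_quiver_C: "wf_digraph quiver_C"
proof
  fix e
  show "tail quiver_C e \<in> verts quiver_C" "head quiver_C e \<in> verts quiver_C"
    by (cases e; simp add: verts_C)+
qed

lemma inj_nxt: "inj nxt"
proof (rule injI)
  show "x = y" if "nxt x = nxt y" for x y
    using that by (cases x; cases y) auto
qed

lemma nxt_eq_C_iff [simp]: "nxt a = C \<longleftrightarrow> a = C"
  by (cases a) auto

lemma funpow_nxt_eq_C_iff [simp]: "(nxt ^^ n) a = C \<longleftrightarrow> a = C"
  by (induction n) auto

lemma C_in_orbit: "x \<in> set (orbit a n) \<Longrightarrow> x = C \<longleftrightarrow> a = C"
proof (induction n arbitrary: a)
  case (Suc n)
  show ?case
    using Suc.IH[of "nxt a"] Suc.prems by auto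
qed simp

lemma orbit_C: "orbit C n = replicate n C"
  by (induction n) auto

lemma head_last_orbit:
  "0 < n \<Longrightarrow> head quiver_C (last (orbit a n)) = tail quiver_C ((nxt ^^ n) a)"
proof (induction n arbitrary: a)
  case (Suc n)
  then show ?case
    by (cases "n = 0") (auto simp: head_eq_tail_nxt funpow_swap1)
qed simp

definition orbit_path :: "arrow \<Rightarrow> nat \<Rightarrow> (nat, arrow) path" where
  "orbit_path a n = (tail quiver_C a, orbit a n, tail quiver_C ((nxt ^^ n) a))"

locale C_relations = quiver_relations quiver_C P S I
  for P :: "('k::field, (nat, arrow) path \<Rightarrow>\<^sub>0 'k) module" and S I +
  fixes r :: nat
  assumes r: "2 \<le> r"
    and S_def: "S = {path_of quiver_C [A1, B1], path_of quiver_C [B2, A2],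
      path_of quiver_C [A2, C], path_of quiver_C [C, B2],
      path_of quiver_C (replicate r C) - path_of quiver_C [B2, B1, A1, A2],
      path_of quiver_C [A2, B2, B1, A1] - path_of quiver_C [B1, A1, A2, B2]}"
begin

text \<open>
  The words \<open>orbit a (len a)\<close> are \<open>c\<^sup>r\<close> and the four rotations of \<open>a\<^sub>1 a\<^sub>2 b\<^sub>2 b\<^sub>1\<close>. They are nonzero,
  while the longer orbit words starting with the same arrow are 0, so they are called words of
  maximal length. The relations that are not monomial compare two of them.
\<close>

definition len :: "arrow \<Rightarrow> nat" where
  "len a = (if a = C then r else 4)"

lemma len_pos [simp]: "0 < len a"
  using r by (simp add: len_def)

lemma walk_iff: "walk (a # w) \<longleftrightarrow> w = [] \<or> head quiver_C a = tail quiver_C (hd w) \<and> walk w"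
  by (simp add: walk_Cons arcs_C)

lemma walk_orbit: "0 < n \<Longrightarrow> walk (orbit a n)"
proof (induction n arbitrary: a)
  case (Suc n)
  then show ?case
    by (cases "n = 0") (auto simp: walk_iff head_eq_tail_nxt)
qed simp

lemma zero_pairs:
  "wp [A1, B1] \<in> I" "wp [B2, A2] \<in> I" "wp [A2, C] \<in> I" "wp [C, B2] \<in> I"
  using S_subset_I by (auto simp: S_def)

lemma long_relations:
  "wp (replicate r C) - wp [B2, B1, A1, A2] \<in> I"
  "wp [A2, B2, B1, A1] - wp [B1, A1, A2, B2] \<in> I"
  using S_subset_I by (auto simp: S_def)

text \<open>
  This form of the relations treats the loop and the cycle alike: a generator is a pair of arrows
  that do not follow each other in an orbit, or the difference of two parallel words of maximal
  length.
\<close>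

lemma S_cases [consumes 1, case_names pair long]:
  assumes "s \<in> S"
    and "\<And>x y. s = wp [x, y] \<Longrightarrow> y \<noteq> nxt x \<Longrightarrow> thesis"
    and "\<And>a b. s = wp (orbit a (len a)) - wp (orbit b (len b)) \<Longrightarrow> tail quiver_C a = tail quiver_C b \<Longrightarrow>
      tail quiver_C ((nxt ^^ len a) a) = tail quiver_C ((nxt ^^ len b) b) \<Longrightarrow> thesis"
  shows thesis
proof -
  have four: "orbit a (len a) = [a, nxt a, nxt (nxt a), nxt (nxt (nxt a))]" "(nxt ^^ len a) a = a"
    if "a \<noteq> C" for a
    using that by (cases a; simp add: len_def eval_nat_numeral)+
  have C: "orbit C (len C) = replicate r C" "(nxt ^^ len C) C = C"
    by (simp_all add: orbit_C len_def)
  consider "s = wp [A1, B1]" | "s = wp [B2, A2]" | "s = wp [A2, C]" | "s = wp [C, B2]"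
    | "s = wp (orbit C (len C)) - wp (orbit B2 (len B2))"
    | "s = wp (orbit A2 (len A2)) - wp (orbit B1 (len B1))"
    using assms(1) unfolding S_def by (auto simp: four C)
  then show thesis
  proof cases
    case 5
    then show ?thesis
      by (rule assms(3)) (simp_all add: four C)
  next
    case 6
    then show ?thesis
      by (rule assms(3)) (simp_all add: four)
  qed (auto intro: assms(2))
qed

text \<open>
  Replacing one of \<open>a\<^sub>2 b\<^sub>2 b\<^sub>1 a\<^sub>1\<close> and \<open>b\<^sub>1 a\<^sub>1 a\<^sub>2 b\<^sub>2\<close> inside the word by the other one creates a zero pair.
\<close>

lemma orbit_5_zero:
  assumes "a \<noteq> C"
  shows "wp (orbit a 5) \<in> I"
proof (cases a)
  case A1
  have "wp [A1, A2, B2, B1, A1] - wp [A1, B1, A1, A2, B2] \<in> I"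
    using wp_context[OF long_relations(2), of "[A1]" "[]"] by (simp add: walk_iff)
  moreover have "wp [A1, B1, A1, A2, B2] \<in> I"
    using wp_zero_context[OF zero_pairs(1), of "[]" "[A1, A2, B2]"] by (simp add: walk_iff)
  ultimately show ?thesis
    using zero_if_related by (simp add: A1 eval_nat_numeral)
next
  case A2
  have "wp [A2, B2, B1, A1, A2] - wp [B1, A1, A2, B2, A2] \<in> I"
    using wp_context[OF long_relations(2), of "[]" "[A2]"] by (simp add: walk_iff)
  moreover have "wp [B1, A1, A2, B2, A2] \<in> I"
    using wp_zero_context[OF zero_pairs(2), of "[B1, A1, A2]" "[]"] by (simp add: walk_iff)
  ultimately show ?thesis
    using zero_if_related by (simp add: A2 eval_nat_numeral)
next
  case B1
  have "wp [B1, A1, A2, B2, B1] - wp [A2, B2, B1, A1, B1] \<in> I"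
    using I_uminus[OF wp_context[OF long_relations(2), of "[]" "[B1]"]] by (simp add: walk_iff)
  moreover have "wp [A2, B2, B1, A1, B1] \<in> I"
    using wp_zero_context[OF zero_pairs(1), of "[A2, B2, B1]" "[]"] by (simp add: walk_iff)
  ultimately show ?thesis
    using zero_if_related by (simp add: B1 eval_nat_numeral)
next
  case B2
  have "wp [B2, B1, A1, A2, B2] - wp [B2, A2, B2, B1, A1] \<in> I"
    using I_uminus[OF wp_context[OF long_relations(2), of "[B2]" "[]"]] by (simp add: walk_iff)
  moreover have "wp [B2, A2, B2, B1, A1] \<in> I"
    using wp_zero_context[OF zero_pairs(2), of "[]" "[B2, B1, A1]"] by (simp add: walk_iff)
  ultimately show ?thesis
    using zero_if_related by (simp add: B2 eval_nat_numeral)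
qed (use assms in simp)

text \<open>The reason is \<open>c c\<^sup>r = (c b\<^sub>2) b\<^sub>1 a\<^sub>1 a\<^sub>2\<close>.\<close>

lemma loop_power_zero: "wp (orbit C (Suc r)) \<in> I"
proof -
  have w: "walk (C # replicate r C)"
    using walk_orbit[of "Suc r" C] by (simp add: orbit_C)
  have "wp (C # replicate r C) - wp [C, B2, B1, A1, A2] \<in> I"
    using wp_context[OF long_relations(1), of "[C]" "[]"] r w by (auto simp: walk_iff)
  moreover have "wp [C, B2, B1, A1, A2] \<in> I"
    using wp_zero_context[OF zero_pairs(4), of "[]" "[B1, A1, A2]"] by (simp add: walk_iff)
  ultimately show ?thesis
    using zero_if_related by (simp add: orbit_C)
qed

lemma long_orbit_zero:
  assumes "len a < n"
  shows "wp (orbit a n) \<in> I"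
proof -
  define k where "k = n - Suc (len a)"
  have n: "n = Suc (len a) + k"
    using assms by (simp add: k_def)
  have "wp (orbit a (Suc (len a))) \<in> I"
    using loop_power_zero orbit_5_zero[of a] by (cases "a = C") (auto simp: len_def)
  moreover have split: "orbit a n = [] @ orbit a (Suc (len a)) @ orbit ((nxt ^^ Suc (len a)) a) k"
    unfolding n by (simp only: orbit_word_add append_Nil)
  moreover have "walk (orbit a n)"
    using assms by (intro walk_orbit) simp
  ultimately show ?thesis
    unfolding split by (intro wp_zero_context) auto
qed

lemma zero_or_orbit:
  assumes "walk w"
  shows "wp w \<in> I \<or> w = orbit (hd w) (length w)"
proof (rule walk_zero_or_orbit[OF _ assms])
  fix a b assume "head quiver_C a = tail quiver_C b"
  then show "b = nxt a \<or> wp [a, b] \<in> I"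
    using zero_pairs by (cases a; cases b) auto
qed

lemma nilpotent: "F (r + 5) \<subseteq> I"
proof (rule F_subset_I)
  fix w assume w: "walk w" "r + 5 \<le> length w"
  then have "len (hd w) < length w"
    by (simp add: len_def)
  then show "wp w \<in> I"
    using zero_or_orbit[OF w(1)] long_orbit_zero by metis
qed simp

sublocale nilpotent_quotient quiver_C P I "quotient_algebra P I"
  by unfold_locales (use I_subset nilpotent in auto)

lemma orbit_path_in_paths: "orbit_path a n \<in> paths quiver_C"
proof (cases "n = 0")
  case True
  then show ?thesis
    by (cases a) (auto simp: orbit_path_def paths_def awalk_Nil_iff verts_C)
next
  case False
  then show ?thesis
    using paths_iff_walk[of "orbit a n"] walk_orbit[of n a] head_last_orbit[of n a]
    by (simp add: orbit_path_def)
qed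

lemma wp_orbit: "0 < n \<Longrightarrow> wp (orbit a n) = term_of (orbit_path a n) 1"
  by (simp add: path_of_def orbit_path_def head_last_orbit)

lemma path_eq_orbit_path:
  assumes "(u, orbit a n, v) \<in> paths quiver_C" "0 < n"
  shows "(u, orbit a n, v) = orbit_path a n"
  using assms paths_iff_walk[of "orbit a n" u v] by (simp add: orbit_path_def head_last_orbit)

text \<open>
  A word of maximal length does not occur properly inside another orbit word of at most maximal
  length: the loop does not mix with the other arrows, and the cycle has only one maximal length.
\<close>

lemma orbit_in_orbit:
  assumes eq: "u @ orbit b m @ v = orbit a n" and "n \<le> len a" "len b \<le> m"
  shows "u = []" "v = []" "a = b" "n = m"
proof -
  have m: "0 < m"
    using assms(3) len_pos[of b] by linarith
  then have "b \<in> set (orbit b m)"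
    by (metis hd_in_set hd_orbit_word orbit_word_eq_Nil_iff not_less_zero)
  then have "b \<in> set (orbit a n)"
    by (simp flip: eq)
  then have "len a = len b"
    using C_in_orbit[of b a n] by (auto simp: len_def)
  moreover have "length u + m + length v = n"
    using arg_cong[OF eq, of length] by simp
  ultimately have "length u = 0" "length v = 0" "n = m"
    using assms(2,3) by linarith+
  then show uv: "u = []" "v = []" and "n = m"
    by auto
  with eq m show "a = b"
    by (metis append_Nil append_Nil2 hd_orbit_word)
qed

lemma finite_orbit_paths: "finite {orbit_path a (len a) | a. True}"
proof -
  have "finite (UNIV :: arrow set)"
    by (rule finite_subset[of _ "{A1, B1, A2, B2, C}"]) (auto intro: arrow.exhaust)
  then show ?thesis
    by (simp add: full_SetCompr_eq)
qed

text \<open>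
  A monomial relation cannot occur inside an orbit word, and by \<open>orbit_in_orbit\<close> the multiples of the
  other relations have coefficients in \<open>W\<close> only if they are these relations themselves. Then the
  assumption \<open>full\<close> makes both terms count, and they cancel. The lemma is used with \<open>W\<close> the set of all
  words of maximal length, and with \<open>W\<close> a single shorter orbit word.
\<close>

lemma coeff_sum_orbit_paths_I:
  assumes W: "W \<subseteq> {orbit_path a n | a n. n \<le> len a}" "finite W"
    and full: "\<And>a b. orbit_path a (len a) \<in> W \<Longrightarrow> orbit_path b (len b) \<in> W"
    and f: "f \<in> I"
  shows "coeff_sum W f = 0"
proof (rule coeff_sum_I[OF _ f])
  fix s :: "(nat, arrow) path \<Rightarrow>\<^sub>0 'k" and p q :: "(nat, arrow) path"
  assume s: "s \<in> S"
  obtain u l x where p: "p = (u, l, x)"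
    by (cases p)
  obtain y l' v where q: "q = (y, l', v)"
    by (cases q)
  have inW: "\<exists>a n. n \<le> len a \<and> w = orbit a n" if "(u', w, v') \<in> W" for u' w v'
  proof -
    from that W(1) obtain a n where "n \<le> len a" "(u', w, v') = orbit_path a n"
      by blast
    then show ?thesis
      by (auto simp: orbit_path_def)
  qed
  from s show "coeff_sum W (term_of p 1 \<star> s \<star> term_of q 1) = 0"
  proof (cases rule: S_cases)
    case (pair a b)
    have "(u, l @ a # b # l', v) \<notin> W"
      using inW orbit_word_successor[of nxt _ _ l a b l'] pair(2) by metis
    then show ?thesis
      using W(2) by (simp add: pair p q path_of_def term_mult_term coeff_sum_term)
  next
    case (long a b)
    have mem: "(u, l @ orbit c (len c) @ l', v) \<in> W \<longleftrightarrow> l = [] \<and> l' = [] \<and> u = tail quiver_C c \<and>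
        v = tail quiver_C ((nxt ^^ len c) c) \<and> orbit_path c (len c) \<in> W" for c
    proof
      assume L: "(u, l @ orbit c (len c) @ l', v) \<in> W"
      then obtain a n where an: "n \<le> len a" "(u, l @ orbit c (len c) @ l', v) = orbit_path a n"
        using W(1) by auto
      then have "l @ orbit c (len c) @ l' = orbit a n"
        by (simp add: orbit_path_def)
      from orbit_in_orbit[OF this an(1)] have "l = []" "l' = []" "a = c" "n = len c"
        by auto
      with an L show "l = [] \<and> l' = [] \<and> u = tail quiver_C c \<and>
          v = tail quiver_C ((nxt ^^ len c) c) \<and> orbit_path c (len c) \<in> W"
        by (simp add: orbit_path_def)
    qed (auto simp: orbit_path_def)
    have "(u, l @ orbit a (len a) @ l', v) \<in> W \<longleftrightarrow> (u, l @ orbit b (len b) @ l', v) \<in> W"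
      unfolding mem using full long by metis
    then show ?thesis
      using W(2) long
      by (simp add: p q wp_orbit orbit_path_def term_mult_term coeff_sum_term coeff_sum_diff
          path_mult_diff_left path_mult_diff_right)
  qed
qed

lemma coeff_at_orbit_path_I:
  assumes "f \<in> I" "n < len a"
  shows "coeff_at f (orbit_path a n) = 0"
proof -
  have "orbit_path b (len b) \<noteq> orbit_path a n" for b
    using orbit_in_orbit[of "[]" b "len b" "[]" a n] assms(2) by (auto simp: orbit_path_def)
  then have "coeff_sum {orbit_path a n} f = 0"
    using assms by (intro coeff_sum_orbit_paths_I) (auto intro: less_imp_le)
  then show ?thesis
    by (simp add: coeff_sum_def)
qed

text \<open>
  Multiply \<open>f\<close> by the word \<open>q\<close> that prolongs \<open>orbit a n\<close> to the word of maximal length. Since \<open>nxt\<close> is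
  injective, no other path becomes a word of maximal length when multiplied by \<open>q\<close>. So the sum of the
  coefficients of \<open>f q\<close> at the words of maximal length, which is 0 because \<open>f q \<in> I\<close>, is the coefficient
  of \<open>f\<close> at \<open>orbit a n\<close>.
\<close>

lemma socle_coeff_zero:
  assumes f: "f \<in> F 0" and ann: "\<And>q. q \<in> F (Suc 0) \<Longrightarrow> f \<star> q \<in> I" and n: "n < len a"
  shows "coeff_at f (orbit_path a n) = 0"
proof -
  define W where "W = {orbit_path b (len b) | b. True}"
  have finW: "finite W"
    unfolding W_def by (rule finite_orbit_paths)
  define c m where "c = (nxt ^^ n) a" and "m = len a - n"
  have m: "0 < m" "len a = n + m"
    using n by (auto simp: m_def)
  have iff: "(u, p @ orbit c m, tail quiver_C ((nxt ^^ m) c)) \<in> W \<longleftrightarrow> (u, p, tail quiver_C c) = orbit_path a n"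
    for u p
  proof
    assume "(u, p @ orbit c m, tail quiver_C ((nxt ^^ m) c)) \<in> W"
    then obtain b where b: "u = tail quiver_C b" "p @ orbit c m = orbit b (len b)"
      by (auto simp: W_def orbit_path_def)
    have "c \<in> set (orbit c m)"
      using m by (metis hd_in_set hd_orbit_word orbit_word_eq_Nil_iff not_less_zero)
    then have "c \<in> set (p @ orbit c m)"
      by simp
    then have "c \<in> set (orbit b (len b))"
      by (simp only: b)
    then have "len b = len a"
      using C_in_orbit[of c b "len b"] by (auto simp: len_def c_def)
    then have "p @ orbit c m = orbit b n @ orbit ((nxt ^^ n) b) m"
      using b m by (simp add: orbit_word_add)
    then have pb: "p = orbit b n" "orbit c m = orbit ((nxt ^^ n) b) m"
      by (auto simp: append_eq_append_conv)
    then have "(nxt ^^ n) a = (nxt ^^ n) b"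
      using m by (metis c_def hd_orbit_word)
    then have "a = b"
      using inj_fn[OF inj_nxt] by (metis injD)
    with pb b show "(u, p, tail quiver_C c) = orbit_path a n"
      by (simp add: orbit_path_def c_def)
  next
    assume "(u, p, tail quiver_C c) = orbit_path a n"
    moreover have "(nxt ^^ m) c = (nxt ^^ len a) a"
      by (simp add: c_def m add.commute funpow_add)
    ultimately have "(u, p @ orbit c m, tail quiver_C ((nxt ^^ m) c)) = orbit_path a (len a)"
      using m by (simp add: orbit_path_def orbit_word_add c_def)
    then show "(u, p @ orbit c m, tail quiver_C ((nxt ^^ m) c)) \<in> W"
      by (auto simp: W_def)
  qed
  have "coeff_sum W (f \<star> wp (orbit c m)) = coeff_at f (orbit_path a n)"
    using f
  proof (induction f rule: F_induct)
    case (single t x)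
    obtain u p v where t: "t = (u, p, v)"
      by (cases t)
    show ?case
    proof (cases "v = tail quiver_C c")
      case True
      then show ?thesis
        using finW iff[of u p] m
        by (simp add: t wp_orbit orbit_path_def[of c m] term_mult_term coeff_sum_term
            lookup_single when_def)
    next
      case False
      then have "t \<noteq> orbit_path a n"
        by (auto simp: t orbit_path_def c_def)
      with False show ?thesis
        using m by (simp add: t wp_orbit orbit_path_def[of c m] term_mult_term lookup_single when_def)
    qed
  qed (auto simp: path_mult_add_left coeff_sum_add lookup_add)
  moreover have "f \<star> wp (orbit c m) \<in> I"
    using m by (intro ann wp_in_F walk_orbit) auto
  then have "coeff_sum W (f \<star> wp (orbit c m)) = 0"
    using finW by (intro coeff_sum_orbit_paths_I) (auto simp: W_def)
  ultimately show ?thesis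
    by simp
qed

lemma K_if_terms:
  assumes "f \<in> F 0" "\<And>t c. t \<in> keys f \<Longrightarrow> term_of t c \<in> K n"
  shows "f \<in> K n"
proof -
  have "keys f \<subseteq> keys f" ..
  then show ?thesis
    by (induction rule: terms_induct) (auto intro: assms(2) K_add)
qed

text \<open>For \<open>a = C\<close> this uses that \<open>c\<^sup>r\<close> equals a word of length 4 in the quotient.\<close>

lemma socle_word_in_K: "wp (orbit a (len a)) \<in> K 4"
proof (cases "a = C")
  case True
  have "wp [B2, B1, A1, A2] \<in> K 4"
    by (intro F_subset_K wp_in_F) (simp_all add: walk_iff)
  from K_add[OF I_subset_K[OF long_relations(1)] this] show ?thesis
    by (simp add: True len_def orbit_C)
next
  case False
  then show ?thesis
    by (intro F_subset_K wp_in_F walk_orbit) (simp_all add: len_def)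
qed

lemma socle_in_K:
  assumes f: "f \<in> F 0" and ann: "\<And>q. q \<in> F (Suc 0) \<Longrightarrow> f \<star> q \<in> I"
  shows "f \<in> K 4"
proof (rule K_if_terms[OF f])
  fix t x assume t: "t \<in> keys f"
  then have path: "t \<in> paths quiver_C"
    using f by (auto simp: F_def)
  have not_short: "t \<noteq> orbit_path a n" if "n < len a" for a n
    using socle_coeff_zero[OF f ann that] t by (auto simp: in_keys_iff)
  obtain u p v where tp: "t = (u, p, v)"
    by (cases t)
  show "term_of t x \<in> K 4"
  proof (cases "p = []")
    case True
    then have "u = v" "v = 1 \<or> v = 2 \<or> v = 3"
      using path by (auto simp: tp paths_def awalk_Nil_iff verts_C)
    then show ?thesis
      using not_short[of 0 A1] not_short[of 0 B1] not_short[of 0 C] True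
      by (auto simp: tp orbit_path_def)
  next
    case False
    have scale: "term_of t x = scale x (wp p)"
      using path False by (simp add: tp path_eq_wp)
    have "walk p"
      using path False by (simp add: tp paths_iff_walk)
    then consider "wp p \<in> I" | "p = orbit (hd p) (length p)"
      using zero_or_orbit by blast
    then have "wp p \<in> K 4"
    proof cases
      case 1
      then show ?thesis
        by (rule I_subset_K)
    next
      case 2
      then have "t = orbit_path (hd p) (length p)"
        using path_eq_orbit_path[of u "hd p" "length p" v] path False by (simp add: tp)
      with not_short have "len (hd p) \<le> length p"
        by (metis leI)
      then consider "len (hd p) = length p" | "len (hd p) < length p"
        by linarith
      then show ?thesis
      proof cases
        case 1
        then show ?thesis
          using 2 socle_word_in_K[of "hd p"] by simp
      next
        case a: 2
        then show ?thesis
          using 2 long_orbit_zero[OF a] I_subset_K by simp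
      qed
    qed
    then show ?thesis
      unfolding scale by (rule K_scale)
  qed
qed

text \<open>
  The hypothesis \<open>deep\<close> says that a word of maximal length lies in a higher power of the radical than
  its length tells, so that it vanishes in the associated graded algebra. Therefore the prefix of
  length \<open>len a - 1\<close> is killed there by everything of positive degree, although it is not in the
  \<open>len a\<close>-th power of the radical.
\<close>

lemma not_tightly_graded_if_socle_deep:
  assumes len: "2 \<le> len a" "len a \<le> 4" and deep: "wp (orbit a (len a)) \<in> K (Suc (len a))"
  shows "\<not> tightly_graded (quotient_algebra P I)"
proof
  assume tight: "tightly_graded (quotient_algebra P I)"
  define d where "d = len a - 1"
  have d: "0 < d" "len a = Suc d"
    using len by (auto simp: d_def)
  have "wp (orbit a d) \<in> K (Suc d)"
  proof (rule tightly_graded_socle[OF tight])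
    show "wp (orbit a d) \<in> F d"
      using d by (intro wp_in_F walk_orbit) auto
    show "wp (orbit a d) \<star> q \<in> K (Suc (Suc d))" if "q \<in> F (Suc 0)" for q
      using that
    proof (induction q rule: F_induct)
      case (single t x)
      obtain u p v where t: "t = (u, p, v)"
        by (cases t)
      with single have p: "p \<noteq> []" and path: "(u, p, v) \<in> paths quiver_C"
        by auto
      show ?case
      proof (cases "u = tail quiver_C ((nxt ^^ d) a)")
        case True
        define w where "w = orbit a d @ p"
        have "(tail quiver_C a, orbit a d, u) \<in> paths quiver_C"
          using orbit_path_in_paths[of a d] True by (simp add: orbit_path_def)
        then have wpath: "(tail quiver_C a, w, v) \<in> paths quiver_C"
          unfolding w_def using path by (rule paths_append)
        have w: "w \<noteq> []" "len a \<le> length w" "hd w = a"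
          using p d by (auto simp: w_def Suc_le_eq)
        have "walk w"
          using wpath w(1) by (simp add: paths_iff_walk)
        have "wp w \<in> K (Suc (Suc d))"
        proof (cases "wp w \<in> I")
          case False
          then have orb: "w = orbit a (length w)"
            using zero_or_orbit[OF \<open>walk w\<close>] w by simp
          with False have "\<not> len a < length w"
            using long_orbit_zero by metis
          with w have "length w = len a"
            by simp
          with orb deep d show ?thesis
            by metis
        qed (rule I_subset_K)
        moreover have "wp (orbit a d) \<star> term_of t x = scale x (wp w)"
          using True d path_eq_wp[OF wpath w(1), of x]
          by (simp add: t wp_orbit orbit_path_def term_mult_term w_def)
        ultimately show ?thesis
          by (simp add: K_scale)
      next
        case False
        then show ?thesis
          using d by (simp add: t wp_orbit orbit_path_def term_mult_term)
      qed
    qed (auto simp: path_mult_add_right intro: K_add)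
    show "f \<in> K (Suc d)" if "f \<in> F 0" "\<And>q. q \<in> F (Suc 0) \<Longrightarrow> f \<star> q \<in> I" for f
      using socle_in_K[OF that] K_mono[of "Suc d" 4] len d by auto
  qed
  then obtain g where g: "g \<in> F (Suc d)" "wp (orbit a d) - g \<in> I"
    by (auto simp: K_def)
  have "orbit_path a d \<notin> keys g"
    using g(1) by (auto simp: F_def orbit_path_def)
  then have "coeff_at (wp (orbit a d) - g) (orbit_path a d) = 1"
    using d by (simp add: lookup_minus wp_orbit in_keys_iff)
  then show False
    using coeff_at_orbit_path_I[OF g(2), of d a] d by simp
qed

text \<open>
  If \<open>r < 4\<close>, the word \<open>c\<^sup>r\<close> lies in the fourth power of the radical; if \<open>r > 4\<close>, the word
  \<open>b\<^sub>2 b\<^sub>1 a\<^sub>1 a\<^sub>2\<close> of length 4 lies in the \<open>r\<close>-th power.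
\<close>

theorem tightly_graded_iff: "tightly_graded (quotient_algebra P I) \<longleftrightarrow> r = 4"
proof
  assume tight: "tightly_graded (quotient_algebra P I)"
  show "r = 4"
  proof (rule ccontr)
    assume "r \<noteq> 4"
    then consider "r < 4" | "5 \<le> r"
      by linarith
    then show False
    proof cases
      case 1
      have "wp (orbit C (len C)) \<in> K (Suc (len C))"
        using socle_word_in_K[of C] K_mono[of "Suc r" 4] 1 by (auto simp: len_def)
      then show False
        using not_tightly_graded_if_socle_deep[of C] tight 1 r by (simp add: len_def)
    next
      case 2
      have eq: "orbit B2 (len B2) = [B2, B1, A1, A2]"
        by (simp add: len_def eval_nat_numeral)
      have "wp (replicate r C) \<in> F 5"
        using 2 walk_orbit[of r C] by (intro wp_in_F) (simp_all add: orbit_C)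
      from K_diff[OF F_subset_K[OF this] I_subset_K[OF long_relations(1)]]
      have "wp (orbit B2 (len B2)) \<in> K (Suc (len B2))"
        unfolding eq by (simp add: len_def)
      then show False
        using not_tightly_graded_if_socle_deep[of B2] tight by (simp add: len_def)
    qed
  qed
next
  assume r4: "r = 4"
  have "degree_part n s \<in> I" if "s \<in> S" for n s
    using that zero_pairs long_relations unfolding S_def r4
    by (auto simp: degree_part_diff degree_part_wp)
  then show "tightly_graded (quotient_algebra P I)"
    by (rule tightly_graded_if_homogeneous[OF degree_part_in_I])
qed

end

section \<open>The algebra \<open>A\<^sub>1\<close>\<close>

text \<open>
  Avoiding the relations \<open>a\<^sub>2 a\<^sub>1\<close> and \<open>b\<^sub>2 b\<^sub>1\<close> leaves one successor for each arrow. The value at \<open>C\<close>, which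
  is not an arrow of this quiver, is arbitrary.
\<close>

fun nxt_A1 :: "arrow \<Rightarrow> arrow" where
  "nxt_A1 A1 = A2" | "nxt_A1 A2 = B1" | "nxt_A1 B1 = B2" | "nxt_A1 B2 = A1" | "nxt_A1 C = C"

lemma arcs_A1: "arcs quiver_A1 = {A1, A2, B1, B2}"
  by (simp add: quiver_A1_def)

lemma tail_head_A1 [simp]:
  "tail quiver_A1 A1 = 1" "tail quiver_A1 A2 = 2" "tail quiver_A1 B1 = 1" "tail quiver_A1 B2 = 3"
  "head quiver_A1 A1 = 2" "head quiver_A1 A2 = 1" "head quiver_A1 B1 = 3" "head quiver_A1 B2 = 1"
  by (simp_all add: quiver_A1_def)

lemma finite_quiver_A1: "finite_quiver quiver_A1 (path_algebra quiver_A1)"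
proof (intro finite_quiver.intro finite_quiver_axioms.intro refl)
  show "wf_digraph quiver_A1"
    by standard (auto simp: quiver_A1_def)
qed (simp add: quiver_A1_def)

lemma relations_as_image: "{x - y | x y. (x, y) \<in> R} = (\<lambda>(x, y). x - y) ` R"
  by force

text \<open>
  All relations are homogeneous. As for the other algebras, exchanging the two sides of
  \<open>a\<^sub>1 a\<^sub>2 b\<^sub>1 b\<^sub>2 = b\<^sub>1 b\<^sub>2 a\<^sub>1 a\<^sub>2\<close> inside an alternating word of length 5 creates a zero pair, so all words of
  length 5 vanish.
\<close>

lemma tightly_graded_A1:
  "tightly_graded (algebra_A1 :: ('k::field, ((nat, arrow) path \<Rightarrow>\<^sub>0 'k) set) module)"
proof -
  define P where "P = (path_algebra quiver_A1 :: ('k, (nat, arrow) path \<Rightarrow>\<^sub>0 'k) module)"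
  define S :: "((nat, arrow) path \<Rightarrow>\<^sub>0 'k) set" where
    "S = {path_of quiver_A1 [A2, A1], path_of quiver_A1 [B2, B1],
      path_of quiver_A1 [A1, A2, B1, B2] - path_of quiver_A1 [B1, B2, A1, A2]}"
  define I where "I = Idl\<^bsub>P\<^esub> S"
  interpret finite_quiver quiver_A1 P
    unfolding P_def by (rule finite_quiver_A1)
  interpret quiver_relations quiver_A1 P S I
  proof
    show "S \<subseteq> F (Suc 0)"
      by (auto simp: S_def walk_Cons arcs_A1 intro!: F_diff wp_in_F)
  qed (rule I_def)
  have walk: "walk (a # w) \<longleftrightarrow> a \<in> {A1, A2, B1, B2} \<and>
      (w = [] \<or> head quiver_A1 a = tail quiver_A1 (hd w) \<and> walk w)" for a w
    by (simp add: walk_Cons arcs_A1)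
  have pairs: "wp [A2, A1] \<in> I" "wp [B2, B1] \<in> I"
    and rel: "wp [A1, A2, B1, B2] - wp [B1, B2, A1, A2] \<in> I"
    using S_subset_I by (auto simp: S_def)
  have five: "wp (orbit_word nxt_A1 a 5) \<in> I" if "a \<in> arcs quiver_A1" for a
  proof -
    have "wp [A1, A2, B1, B2, A1] - wp [B1, B2, A1, A2, A1] \<in> I" "wp [B1, B2, A1, A2, A1] \<in> I"
      using wp_context[OF rel, of "[]" "[A1]"] wp_zero_context[OF pairs(1), of "[B1, B2, A1]" "[]"]
      by (simp_all add: walk)
    then have 1: "wp [A1, A2, B1, B2, A1] \<in> I"
      by (rule zero_if_related)
    have "wp [A2, B1, B2, A1, A2] - wp [A2, A1, A2, B1, B2] \<in> I" "wp [A2, A1, A2, B1, B2] \<in> I"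
      using I_uminus[OF wp_context[OF rel, of "[A2]" "[]"]]
        wp_zero_context[OF pairs(1), of "[]" "[A2, B1, B2]"]
      by (simp_all add: walk)
    then have 2: "wp [A2, B1, B2, A1, A2] \<in> I"
      by (rule zero_if_related)
    have "wp [B1, B2, A1, A2, B1] - wp [A1, A2, B1, B2, B1] \<in> I" "wp [A1, A2, B1, B2, B1] \<in> I"
      using I_uminus[OF wp_context[OF rel, of "[]" "[B1]"]]
        wp_zero_context[OF pairs(2), of "[A1, A2, B1]" "[]"]
      by (simp_all add: walk)
    then have 3: "wp [B1, B2, A1, A2, B1] \<in> I"
      by (rule zero_if_related)
    have "wp [B2, A1, A2, B1, B2] - wp [B2, B1, B2, A1, A2] \<in> I" "wp [B2, B1, B2, A1, A2] \<in> I"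
      using wp_context[OF rel, of "[B2]" "[]"] wp_zero_context[OF pairs(2), of "[]" "[B2, A1, A2]"]
      by (simp_all add: walk)
    then have 4: "wp [B2, A1, A2, B1, B2] \<in> I"
      by (rule zero_if_related)
    from that 1 2 3 4 show ?thesis
      by (auto simp: arcs_A1 eval_nat_numeral)
  qed
  have nilpotent: "F 5 \<subseteq> I"
  proof (rule F_subset_I)
    fix w assume w: "walk w" "5 \<le> length w"
    consider "wp w \<in> I" | "w = orbit_word nxt_A1 (hd w) (length w)"
    proof -
      have "b = nxt_A1 a \<or> wp [a, b] \<in> I"
        if "a \<in> arcs quiver_A1" "b \<in> arcs quiver_A1" "head quiver_A1 a = tail quiver_A1 b" for a b
        using that pairs by (auto simp: arcs_A1)
      from walk_zero_or_orbit[OF this w(1)] show thesis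
        using that by blast
    qed
    then show "wp w \<in> I"
    proof cases
      case 2
      define v where "v = orbit_word nxt_A1 ((nxt_A1 ^^ 5) (hd w)) (length w - 5)"
      have split: "w = [] @ orbit_word nxt_A1 (hd w) 5 @ v"
        using 2 w(2) orbit_word_add[of nxt_A1 "hd w" 5 "length w - 5"] by (simp add: v_def)
      have "hd w \<in> arcs quiver_A1"
        using w by (cases w) (auto simp: walk_Cons)
      from wp_zero_context[OF five[OF this], of "[]" v] w(1) split show ?thesis
        by simp
    qed
  qed simp
  interpret nilpotent_quotient quiver_A1 P I "quotient_algebra P I"
    by unfold_locales (use I_subset nilpotent in auto)
  have "degree_part n s \<in> I" if "s \<in> S" for n s
    using that pairs rel unfolding S_def by (auto simp: degree_part_diff degree_part_wp)
  then have "tightly_graded (quotient_algebra P I)"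
    by (rule tightly_graded_if_homogeneous[OF degree_part_in_I])
  then show ?thesis
    unfolding algebra_A1_def quiver_algebra_def Let_def relations_as_image
    by (simp add: P_def I_def S_def)
qed

section \<open>Conclusion\<close>

lemma tightly_graded_C_iff:
  assumes "2 \<le> r"
  shows "tightly_graded (algebra_C r :: ('k::field, ((nat, arrow) path \<Rightarrow>\<^sub>0 'k) set) module) \<longleftrightarrow> r = 4"
proof -
  define P where "P = (path_algebra quiver_C :: ('k, (nat, arrow) path \<Rightarrow>\<^sub>0 'k) module)"
  define S :: "((nat, arrow) path \<Rightarrow>\<^sub>0 'k) set" where
    "S = {path_of quiver_C [A1, B1], path_of quiver_C [B2, A2],
      path_of quiver_C [A2, C], path_of quiver_C [C, B2],
      path_of quiver_C (replicate r C) - path_of quiver_C [B2, B1, A1, A2],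
      path_of quiver_C [A2, B2, B1, A1] - path_of quiver_C [B1, A1, A2, B2]}"
  define I where "I = Idl\<^bsub>P\<^esub> S"
  interpret finite_quiver quiver_C P
    by (intro finite_quiver.intro finite_quiver_axioms.intro wf_quiver_C) (simp_all add: verts_C P_def)
  have "walk (C # replicate n C)" for n
    by (induction n) (auto simp: walk_Cons arcs_C)
  then have loops: "walk (replicate r C)"
    using assms by (cases r) auto
  interpret C_relations P S I r
  proof
    show "S \<subseteq> F (Suc 0)"
      using loops assms by (auto simp: S_def walk_Cons arcs_C intro!: F_diff wp_in_F)
  qed (use assms in \<open>simp_all add: I_def S_def\<close>)
  have "algebra_C r = quotient_algebra P I"
    using assms unfolding algebra_C_def quiver_algebra_def Let_def relations_as_image
    by (simp add: P_def I_def S_def)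
  then show ?thesis
    using tightly_graded_iff by simp
qed

theorem proposition3p9:
  fixes r :: nat
  assumes "CHAR('k::alg_closed_field) = 2"
    and "r \<ge> 1"
  shows "tightly_graded (algebra_C r :: ('k, ((nat, arrow) path \<Rightarrow>\<^sub>0 'k) set) module)
    \<longleftrightarrow> r = 1 \<or> r = 4"
proof (cases "r = 1")
  case True
  then show ?thesis
    using tightly_graded_A1 by (simp add: algebra_C_def)
next
  case False
  with assms show ?thesis
    using tightly_graded_C_iff[of r] by simp
qed

end
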